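(* Let $c>0$, $a>0$, and let $f:\mathbb R\to\mathbb R$ be a function of class $\mathcal C^2$ whose first and second derivatives are bounded. Let $$u(x,t)=\frac12\big\{f(x+at)+f(x-at)\big\},\qquad x\in\mathbb R,\ t\in\mathbb R,$$ and let $(N^c_t)_{t\ge0}$ be a Poisson process with rate $c$ ($N^c_0=0$). Then the function $$w(x,t)=\mathbb E\Big[u\Big(x,\int_0^t(-1)^{N^c_s}ds\Big)\Big],\qquad x\in\mathbb R,\ t\ge0,$$ is the solution of the telegraph equation $$\frac{\partial^2w}{\partial t^2}+2c\frac{\partial w}{\partial t}=a^2\frac{\partial^2w}{\partial x^2},\qquad w(x,0)=f(x),\quad \frac{\partial w}{\partial t}(x,0)=0 .$$
   Context: The function $u$ is the solution of the wave equation $\frac{\partial^2u}{\partial t^2}=a^2\frac{\partial^2u}{\partial x^2}$ with $u(x,0)=f(x)$ and $\frac{\partial u}{\partial t}(x,0)=0$. *)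

theory Defs
  imports "HOL-Probability.Probability"
begin

text \<open>
  The process is indexed by \<^typ>\<open>real\<close>, but only times \<open>t \<ge> 0\<close> are constrained.
  Path regularity is required for every outcome, not just almost surely: the underlying space is
  not assumed to be complete, and path integrals of \<open>N\<close> have to be random variables.
  The truncated subtraction on \<^typ>\<open>nat\<close> is harmless in the increments since paths are
  nondecreasing.
\<close>

locale poisson_process = prob_space M for M :: "'a measure" +
  fixes N :: "real \<Rightarrow> 'a \<Rightarrow> nat" and c :: real
  assumes rate_pos: "c > 0"
    and random_variable_N: "\<And>t. t \<ge> 0 \<Longrightarrow> random_variable (count_space UNIV) (N t)"
    and N_zero: "AE \<omega> in M. N 0 \<omega> = 0"
    and path_mono: "\<And>\<omega>. \<omega> \<in> space M \<Longrightarrow> mono_on {0..} (\<lambda>t. N t \<omega>)"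
    and path_right_continuous:
      "\<And>\<omega> t. \<omega> \<in> space M \<Longrightarrow> t \<ge> 0 \<Longrightarrow> continuous (at_right t) (\<lambda>s. N s \<omega>)"
    and increment_distr:
      "\<And>s t. 0 \<le> s \<Longrightarrow> s < t \<Longrightarrow>
        distr M (count_space UNIV) (\<lambda>\<omega>. N t \<omega> - N s \<omega>) = measure_pmf (poisson_pmf (c * (t - s)))"
    and independent_increments:
      "\<And>(n::nat) \<tau>. 0 \<le> \<tau> 0 \<Longrightarrow> mono \<tau> \<Longrightarrow>
        indep_vars (\<lambda>_. count_space UNIV) (\<lambda>i \<omega>. N (\<tau> (Suc i)) \<omega> - N (\<tau> i) \<omega>) {..<n}"

text \<open>
  Calculus on the closed half-plane \<open>t \<ge> 0\<close>; at \<open>t = 0\<close> the time derivative is one-sided.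
\<close>

definition partial_x :: "(real \<Rightarrow> real \<Rightarrow> real) \<Rightarrow> real \<Rightarrow> real \<Rightarrow> real" where
  "partial_x v x t = deriv (\<lambda>y. v y t) x"

definition partial_t :: "(real \<Rightarrow> real \<Rightarrow> real) \<Rightarrow> real \<Rightarrow> real \<Rightarrow> real" where
  "partial_t v x t = vector_derivative (\<lambda>s. v x s) (at t within {0..})"

definition C1_halfplane :: "(real \<Rightarrow> real \<Rightarrow> real) \<Rightarrow> bool" where
  "C1_halfplane v \<longleftrightarrow>
     (\<forall>x. \<forall>t\<ge>0. (\<lambda>y. v y t) differentiable (at x) \<and> (\<lambda>s. v x s) differentiable (at t within {0..})) \<and>
     continuous_on (UNIV \<times> {0..}) (\<lambda>(x, t). partial_x v x t) \<and>
     continuous_on (UNIV \<times> {0..}) (\<lambda>(x, t). partial_t v x t)"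

definition C2_halfplane :: "(real \<Rightarrow> real \<Rightarrow> real) \<Rightarrow> bool" where
  "C2_halfplane v \<longleftrightarrow> C1_halfplane v \<and> C1_halfplane (partial_x v) \<and> C1_halfplane (partial_t v)"

definition telegraph_solution ::
  "real \<Rightarrow> real \<Rightarrow> (real \<Rightarrow> real) \<Rightarrow> (real \<Rightarrow> real \<Rightarrow> real) \<Rightarrow> bool" where
  "telegraph_solution c a f v \<longleftrightarrow>
     C2_halfplane v \<and>
     (\<forall>x. \<forall>t\<ge>0. partial_t (partial_t v) x t + 2 * c * partial_t v x t
                 = a\<^sup>2 * partial_x (partial_x v) x t) \<and>
     (\<forall>x. v x 0 = f x) \<and>
     (\<forall>x. partial_t v x 0 = 0)"

end

theory Submission
  imports Defs
begin

text \<open>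
  Write \<open>\<epsilon>\<^sub>t = (-1)\<^bsup>N\<^sub>t\<^esup>\<close> for the current direction of motion and
  \<open>T\<^sub>t = \<integral>\<^sub>0\<^sup>t \<epsilon>\<^sub>s ds\<close> for the displacement.  Everything on the existence side follows from a closed
  system for the two families of expectations
  \<open>A\<^sub>\<psi>(x,t) = E[\<psi>(x + a T\<^sub>t)]\<close> and \<open>B\<^sub>\<psi>(x,t) = E[\<psi>(x + a T\<^sub>t) \<epsilon>\<^sub>t]\<close>, namely
  \<open>\<partial>\<^sub>t A\<^sub>\<phi> = a B\<^sub>\<phi>\<^sub>'\<close> and \<open>\<partial>\<^sub>t B\<^sub>\<phi> = a A\<^sub>\<phi>\<^sub>' - 2 c B\<^sub>\<phi>\<close>,
  together with \<open>\<partial>\<^sub>x A\<^sub>\<phi> = A\<^sub>\<phi>\<^sub>'\<close> and \<open>\<partial>\<^sub>x B\<^sub>\<phi> = B\<^sub>\<phi>\<^sub>'\<close>.  Applying the first equation to \<open>f\<close>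
  and the second to \<open>f'\<close> shows that \<open>A\<^sub>f\<close> solves the telegraph equation.  The function \<open>w\<close> is the mean of
  \<open>A\<^sub>f\<close> for the speeds \<open>a\<close> and \<open>-a\<close>; at time \<open>0\<close> the two time derivatives are opposite, so
  they cancel.

  The first equation of the system is the chain rule along a path, because almost surely \<open>N\<close> does not
  jump at a given time.  The damping term of the second one comes from the independence of the
  increments: \<open>N\<^sub>t - N\<^sub>s\<close> is independent of the past up to time \<open>s\<close>, and its parity
  has mean \<open>exp (-2c(t-s))\<close>.  Hence \<open>E[\<psi>(T\<^sub>s) \<epsilon>\<^sub>t] = exp (-2c(t-s)) E[\<psi>(T\<^sub>s) \<epsilon>\<^sub>s]\<close>
  (\<open>expectation_direction_later\<close>), which is proved by replacing \<open>T\<^sub>s\<close> with Riemann sums: these are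
  functions of finitely many increments.  Limits in \<open>x\<close> and \<open>t\<close> pass under the expectation by
  \<open>tendsto_expectation_at_within\<close>; constant bounds suffice because \<open>\<bar>T\<^sub>t\<bar> \<le> t\<close> confines the argument
  of \<open>\<psi>\<close> to a compact interval.

  Uniqueness is a finite-speed argument.  If \<open>z\<close> solves the homogeneous problem, then
  \<open>z\<^sub>t + \<sigma> z\<^sub>x\<close> with \<open>\<sigma> = \<plusminus>a\<close> has derivative \<open>-2c z\<^sub>t\<close> along the lines
  \<open>x = p - \<sigma>t\<close> and vanishes initially.  On a backward characteristic triangle, the supremum of both
  quantities weighted by \<open>exp (-4ct)\<close> is then at most half of itself, hence zero (\<open>telegraph_solution_zero\<close>).
\<close>

section \<open>Paths of the Poisson process and the displacement they generate\<close>

context poisson_process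
begin

definition direction :: "real \<Rightarrow> 'a \<Rightarrow> real" where
  "direction t \<omega> = (-1) ^ N t \<omega>"

definition displacement :: "real \<Rightarrow> 'a \<Rightarrow> real" where
  "displacement t \<omega> = (LBINT s:{0..t}. direction s \<omega>)"

lemma abs_direction [simp]: "\<bar>direction t \<omega>\<bar> = 1"
  by (simp add: direction_def power_abs)

lemma direction_square [simp]: "direction t \<omega> * direction t \<omega> = 1"
  by (simp add: direction_def flip: power_mult_distrib)

lemma measurable_direction: "t \<ge> 0 \<Longrightarrow> direction t \<in> borel_measurable M"
  using measurable_compose[OF random_variable_N, of t "\<lambda>k. (-1::real) ^ k" borel]
  by (simp add: direction_def[abs_def])

lemma N_mono: "\<omega> \<in> space M \<Longrightarrow> 0 \<le> s \<Longrightarrow> s \<le> t \<Longrightarrow> N s \<omega> \<le> N t \<omega>"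
  using path_mono[of \<omega>] by (auto simp: mono_on_def)

lemma direction_set_integrable:
  assumes "\<omega> \<in> space M" "A \<in> sets borel" "A \<subseteq> {0..t}"
  shows "set_integrable lborel A (\<lambda>s. direction s \<omega>)"
proof -
  have "mono_on {0..} (\<lambda>s. real (N s \<omega>))"
    using path_mono[OF assms(1)] by (auto simp: mono_on_def)
  then have "(\<lambda>s. real (N s \<omega>)) \<in> borel_measurable (restrict_space borel {0..})"
    by (rule borel_measurable_mono_on_fnc)
  then have "(\<lambda>s. (-1::real) ^ nat \<lfloor>real (N s \<omega>)\<rfloor>) \<in> borel_measurable (restrict_space borel {0..})"
    by measurable
  then have "(\<lambda>s. direction s \<omega>) \<in> borel_measurable (restrict_space borel {0..})"
    by (simp add: direction_def)
  then have [measurable]: "(\<lambda>s. indicator {0..} s *\<^sub>R direction s \<omega>) \<in> borel_measurable borel"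
    by (subst (asm) borel_measurable_restrict_space_iff) auto
  have [measurable]: "A \<in> sets borel" by fact
  have eq: "(\<lambda>s. indicator A s *\<^sub>R direction s \<omega>)
      = (\<lambda>s. indicator A s *\<^sub>R (indicator {0..} s *\<^sub>R direction s \<omega>))"
    using assms(3) by (auto simp: indicator_def fun_eq_iff)
  have meas: "(\<lambda>s. indicator A s *\<^sub>R direction s \<omega>) \<in> borel_measurable lborel"
    unfolding eq by measurable
  show ?thesis
    unfolding set_integrable_def
  proof (rule Bochner_Integration.integrable_bound[OF _ meas])
    show "integrable lborel (indicator {0..t} :: real \<Rightarrow> real)"
      by (simp add: integrable_indicator_iff emeasure_lborel_Icc_eq)
    show "AE s in lborel. norm (indicator A s *\<^sub>R direction s \<omega>) \<le> norm (indicator {0..t} s :: real)"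
      using assms(3) by (intro AE_I2) (auto simp: indicator_def abs_mult)
  qed
qed

text \<open>
  The constant \<open>e\<close> is a guess for the direction on the interval and \<open>K\<close> the error of the guess.
  The choice \<open>e = 0\<close>, \<open>K = 1\<close> gives the Lipschitz bound, \<open>K = 0\<close> gives linear motion between jumps,
  and \<open>K\<close> proportional to an increment of \<open>N\<close> gives the error of a Riemann sum.
\<close>

lemma displacement_approx:
  assumes \<omega>: "\<omega> \<in> space M" and "0 \<le> r" "r \<le> t"
    and e: "\<And>s. r < s \<Longrightarrow> s \<le> t \<Longrightarrow> \<bar>direction s \<omega> - e\<bar> \<le> K"
  shows "\<bar>displacement t \<omega> - displacement r \<omega> - e * (t - r)\<bar> \<le> K * (t - r)"
proof -
  note int = direction_set_integrable[OF \<omega>, of _ t]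
  have const: "set_integrable lborel {r<..t} (\<lambda>s. b)" for b :: real
    unfolding set_integrable_def by (simp add: integrable_indicator_iff emeasure_lborel_Ioc \<open>r \<le> t\<close>)
  have const_int: "(LBINT s:{r<..t}. b) = b * (t - r)" for b :: real
    using \<open>r \<le> t\<close> by (simp add: set_lebesgue_integral_def)
  have "{0..t} = {0..r} \<union> {r<..t}"
    using assms by auto
  then have "displacement t \<omega> = displacement r \<omega> + (LBINT s:{r<..t}. direction s \<omega>)"
    unfolding displacement_def using assms
    by (simp only:) (rule set_integral_Un, auto intro!: int)
  then have eq: "displacement t \<omega> - displacement r \<omega> - e * (t - r) = (LBINT s:{r<..t}. direction s \<omega> - e)"
    using assms by (subst set_integral_diff) (auto intro!: int const simp: const_int)
  have int_diff: "set_integrable lborel {r<..t} (\<lambda>s. direction s \<omega> - e)"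
    using assms by (intro set_integral_diff int const) auto
  have "\<bar>LBINT s:{r<..t}. direction s \<omega> - e\<bar> \<le> (LBINT s:{r<..t}. \<bar>direction s \<omega> - e\<bar>)"
    using set_integral_norm_bound[OF int_diff] by simp
  also have "\<dots> \<le> (LBINT s:{r<..t}. K)"
    using e by (intro set_integral_mono const set_integrable_abs int_diff) auto
  finally show ?thesis
    by (simp add: eq const_int)
qed

lemma displacement_0 [simp]: "displacement 0 \<omega> = 0"
  unfolding displacement_def set_lebesgue_integral_def
  by (rule integral_eq_zero_AE, rule AE_mp[OF AE_lborel_singleton[of 0]]) auto

lemma displacement_lipschitz:
  assumes "\<omega> \<in> space M" and "0 \<le> r" "r \<le> t"
  shows "\<bar>displacement t \<omega> - displacement r \<omega>\<bar> \<le> t - r"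
  using displacement_approx[OF assms, of 0 1] by simp

lemma abs_displacement_le:
  assumes "\<omega> \<in> space M" and "0 \<le> t"
  shows "\<bar>displacement t \<omega>\<bar> \<le> t"
  using displacement_lipschitz[of \<omega> 0 t] assms by simp

definition riemann_sum :: "real \<Rightarrow> nat \<Rightarrow> 'a \<Rightarrow> real" where
  "riemann_sum t n \<omega> = (t / n) * (\<Sum>k<n. direction (real (Suc k) * (t / n)) \<omega>)"

text \<open>
  On a cell of the partition the direction can differ from its value at the right end point only if \<open>N\<close>
  jumps inside the cell; bounding the indicator of this event by the increment of \<open>N\<close> over the cell makes
  the errors telescope.
\<close>

lemma riemann_sum_error:
  assumes \<omega>: "\<omega> \<in> space M" and "0 \<le> t" "0 < n"
  shows "\<bar>displacement t \<omega> - riemann_sum t n \<omega>\<bar> \<le> 2 * (t / n) * (real (N t \<omega>) - real (N 0 \<omega>))"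
proof -
  define h where "h = t / n"
  have "h \<ge> 0" using assms by (simp add: h_def)
  have "\<bar>displacement (real m * h) \<omega> - h * (\<Sum>k<m. direction (real (Suc k) * h) \<omega>)\<bar>
      \<le> 2 * h * (real (N (real m * h) \<omega>) - real (N 0 \<omega>))" for m
  proof (induction m)
    case 0
    then show ?case by simp
  next
    case (Suc m)
    let ?r = "real m * h" and ?t = "real (Suc m) * h"
    have r: "0 \<le> ?r" "?r \<le> ?t" "?t - ?r = h"
      using \<open>h \<ge> 0\<close> by (auto simp: algebra_simps)
    \<comment> \<open>A change of direction needs a jump, and \<open>\<bar>\<epsilon>\<^sub>s - \<epsilon>\<^sub>t\<bar> \<le> 2\<close> in any case.\<close>
    have "\<bar>direction s \<omega> - direction ?t \<omega>\<bar> \<le> 2 * (real (N ?t \<omega>) - real (N ?r \<omega>))"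
      if "?r < s" "s \<le> ?t" for s
    proof (cases "N ?t \<omega> = N ?r \<omega>")
      case True
      then have "N s \<omega> = N ?t \<omega>"
        using N_mono[OF \<omega>, of ?r s] N_mono[OF \<omega>, of s ?t] that r(1) by simp
      then show ?thesis using True by (simp add: direction_def)
    next
      case False
      then have "real (N ?t \<omega>) - real (N ?r \<omega>) \<ge> 1"
        using N_mono[OF \<omega> r(1,2)] by linarith
      then have "2 * 1 \<le> 2 * (real (N ?t \<omega>) - real (N ?r \<omega>))"
        by (intro mult_left_mono) auto
      moreover have "\<bar>direction s \<omega> - direction ?t \<omega>\<bar> \<le> 2"
        using abs_triangle_ineq4[of "direction s \<omega>" "direction ?t \<omega>"] by simp
      ultimately show ?thesis by (metis (no_types) mult_1_right order_trans)
    qed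
    from displacement_approx[OF \<omega> r(1,2) this]
    have "\<bar>displacement ?t \<omega> - displacement ?r \<omega> - direction ?t \<omega> * h\<bar>
        \<le> 2 * (real (N ?t \<omega>) - real (N ?r \<omega>)) * h"
      unfolding r(3) by blast
    with Suc.IH show ?case
      by (simp add: algebra_simps)
  qed
  from this[of n] show ?thesis
    using assms by (simp add: h_def riemann_sum_def)
qed

lemma riemann_sum_tendsto:
  assumes "\<omega> \<in> space M" "0 \<le> t"
  shows "(\<lambda>n. riemann_sum t (Suc n) \<omega>) \<longlonglongrightarrow> displacement t \<omega>"
proof (rule Lim_transform2[OF tendsto_const])
  have "(\<lambda>n. 2 * t * (real (N t \<omega>) - real (N 0 \<omega>)) * inverse (real (Suc n))) \<longlonglongrightarrow> 0"
    by (intro tendsto_mult_right_zero LIMSEQ_inverse_real_of_nat)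
  then show "(\<lambda>n. displacement t \<omega> - riemann_sum t (Suc n) \<omega>) \<longlonglongrightarrow> 0"
  proof (rule Lim_null_comparison[rotated], intro always_eventually allI)
    show "norm (displacement t \<omega> - riemann_sum t (Suc n) \<omega>)
        \<le> 2 * t * (real (N t \<omega>) - real (N 0 \<omega>)) * inverse (real (Suc n))" for n
      using riemann_sum_error[OF assms, of "Suc n"] by (simp add: divide_inverse algebra_simps)
  qed
qed

lemma measurable_riemann_sum: "0 \<le> t \<Longrightarrow> riemann_sum t n \<in> borel_measurable M"
  unfolding riemann_sum_def[abs_def]
  by (intro borel_measurable_times borel_measurable_const borel_measurable_sum measurable_direction) auto

lemma abs_riemann_sum_le: "0 \<le> t \<Longrightarrow> \<bar>riemann_sum t n \<omega>\<bar> \<le> t"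
proof -
  assume "0 \<le> t"
  have "\<bar>\<Sum>k<n. direction (real (Suc k) * (t / n)) \<omega>\<bar> \<le> (\<Sum>k<n. 1)"
    by (rule order_trans[OF sum_abs]) simp
  then have "\<bar>riemann_sum t n \<omega>\<bar> \<le> t / n * n"
    unfolding riemann_sum_def abs_mult using \<open>0 \<le> t\<close> by (intro mult_mono) auto
  then show ?thesis
    using \<open>0 \<le> t\<close> by (cases "n = 0") auto
qed

lemma measurable_displacement: "0 \<le> t \<Longrightarrow> displacement t \<in> borel_measurable M"
  by (rule borel_measurable_LIMSEQ_real[OF riemann_sum_tendsto measurable_riemann_sum])

end

section \<open>Parity of Poisson increments and the decorrelation of the direction\<close>

lemma continuous_bounded_on_interval:
  fixes \<psi> :: "real \<Rightarrow> real"
  assumes "continuous_on UNIV \<psi>"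
  obtains C where "C \<ge> 0" "\<And>y. \<bar>y\<bar> \<le> R \<Longrightarrow> \<bar>\<psi> y\<bar> \<le> C"
proof -
  have "compact (\<psi> ` cball 0 R)"
    using assms by (intro compact_continuous_image) (auto intro: continuous_on_subset)
  from compact_imp_bounded[OF this] obtain C where "\<And>z. z \<in> \<psi> ` cball 0 R \<Longrightarrow> norm z \<le> C"
    unfolding bounded_iff by blast
  then have "\<bar>\<psi> y\<bar> \<le> max 0 C" if "\<bar>y\<bar> \<le> R" for y
    using that by force
  then show ?thesis by (intro that[of "max 0 C"]) auto
qed

text \<open>
  The series \<open>exp (-\<lambda>) \<Sum>k. (-\<lambda>)\<^sup>k / k!\<close>, where \<open>\<lambda>\<close> is the rate, is the product of two exponentials.
\<close>

lemma poisson_expectation_parity: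
  assumes "rate > 0"
  shows "(\<integral>k. (-1) ^ k \<partial>measure_pmf (poisson_pmf rate)) = exp (- 2 * rate)"
proof -
  let ?g = "\<lambda>k. exp (-rate) * ((-rate) ^ k /\<^sub>R fact k)"
  have eq: "pmf (poisson_pmf rate) k *\<^sub>R (-1::real) ^ k = ?g k" for k
    using assms by (simp add: divide_inverse power_minus[of rate] mult_ac)
  have "?g sums (exp (-rate) * exp (-rate))"
    by (intro sums_mult exp_converges)
  moreover have "summable (\<lambda>k. norm (?g k))"
    unfolding norm_mult by (intro summable_mult summable_norm_exp)
  then have "integrable (count_space UNIV) ?g"
    unfolding integrable_count_space_nat_iff .
  ultimately have "integral\<^sup>L (count_space UNIV) ?g = exp (-rate) * exp (-rate)"
    by (metis integral_count_space_nat sums_unique)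
  then show ?thesis
    unfolding measure_pmf_eq_density
    by (subst integral_density) (auto simp only: eq AE_count_space intro!: measurable_count_space_eq1, auto simp flip: exp_add)
qed

text \<open>
  Dominated convergence along a punctured neighbourhood, which reduces to sequences because the
  index space is first countable.
\<close>

lemma (in prob_space) tendsto_expectation_at_within:
  fixes X :: "'b::first_countable_topology \<Rightarrow> 'a \<Rightarrow> real"
  assumes X: "\<And>q. q \<in> S \<Longrightarrow> X q \<in> borel_measurable M"
    and Y: "Y \<in> borel_measurable M"
    and bound: "\<forall>\<^sub>F q in at p within S. \<forall>\<omega>\<in>space M. \<bar>X q \<omega>\<bar> \<le> C"
    and lim: "AE \<omega> in M. ((\<lambda>q. X q \<omega>) \<longlongrightarrow> Y \<omega>) (at p within S)"
  shows "((\<lambda>q. expectation (X q)) \<longlongrightarrow> expectation Y) (at p within S)"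
  unfolding tendsto_at_iff_sequentially comp_def
proof (intro allI impI)
  fix \<sigma> assume \<sigma>: "\<forall>i. \<sigma> i \<in> S - {p}" "\<sigma> \<longlonglongrightarrow> p"
  then have filt: "filterlim \<sigma> (at p within S) sequentially"
    by (auto simp: filterlim_at)
  from eventually_compose_filterlim[OF bound filt]
  obtain n0 where n0: "\<And>n \<omega>. n \<ge> n0 \<Longrightarrow> \<omega> \<in> space M \<Longrightarrow> \<bar>X (\<sigma> n) \<omega>\<bar> \<le> C"
    by (auto simp: eventually_sequentially)
  have "(\<lambda>n. expectation (X (\<sigma> (n + n0)))) \<longlonglongrightarrow> expectation Y"
  proof (rule integral_dominated_convergence[where w="\<lambda>_. C"])
    show "AE \<omega> in M. (\<lambda>n. X (\<sigma> (n + n0)) \<omega>) \<longlonglongrightarrow> Y \<omega>"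
      using lim by eventually_elim (rule LIMSEQ_ignore_initial_segment[OF filterlim_compose[OF _ filt]])
  qed (use X Y \<sigma> n0 in auto)
  then show "(\<lambda>n. expectation (X (\<sigma> n))) \<longlonglongrightarrow> expectation Y"
    by (rule LIMSEQ_offset)
qed

context poisson_process
begin

lemma increment_measurable:
  assumes "0 \<le> s" "0 \<le> t"
  shows "(\<lambda>\<omega>. N t \<omega> - N s \<omega>) \<in> measurable M (count_space UNIV)"
  by (rule measurable_compose_countable[OF _ random_variable_N[OF assms(1)], of "\<lambda>k \<omega>. N t \<omega> - k"])
     (rule measurable_compose[OF random_variable_N[OF assms(2)]], simp)

lemma jump_event:
  assumes "0 \<le> s" "s \<le> t"
  shows "{\<omega> \<in> space M. N t \<omega> \<noteq> N s \<omega>} \<in> events"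
proof -
  have "{\<omega> \<in> space M. N t \<omega> \<noteq> N s \<omega>} = (\<lambda>\<omega>. N t \<omega> - N s \<omega>) -` {0<..} \<inter> space M"
    using N_mono[of _ s t] assms by (force simp: le_less)
  then show ?thesis
    using measurable_sets[OF increment_measurable[of s t]] assms by simp
qed

lemma prob_increment_pos:
  assumes "0 \<le> s" "s < t"
  shows "prob {\<omega> \<in> space M. N t \<omega> \<noteq> N s \<omega>} = 1 - exp (- c * (t - s))"
proof -
  have "0 \<le> t" using assms by simp
  note [measurable] = increment_measurable[OF \<open>0 \<le> s\<close> \<open>0 \<le> t\<close>]
  let ?Z = "(\<lambda>\<omega>. N t \<omega> - N s \<omega>) -` {0} \<inter> space M"
  have Z: "?Z \<in> events" by measurable
  have "prob ?Z = measure (distr M (count_space UNIV) (\<lambda>\<omega>. N t \<omega> - N s \<omega>)) {0}"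
    by (subst measure_distr) auto
  also have "\<dots> = exp (- c * (t - s))"
    unfolding increment_distr[OF assms] measure_pmf_single
    using assms rate_pos by simp
  finally have "prob ?Z = exp (- c * (t - s))" .
  moreover have "{\<omega> \<in> space M. N t \<omega> \<noteq> N s \<omega>} = space M - ?Z"
    using N_mono[of _ s t] assms by (force dest: order_antisym)
  ultimately show ?thesis
    using prob_compl[OF Z] by simp
qed

lemma expectation_increment_parity:
  assumes "0 \<le> s" "s < t"
  shows "expectation (\<lambda>\<omega>. (-1) ^ (N t \<omega> - N s \<omega>)) = exp (- 2 * c * (t - s))"
proof -
  have "expectation (\<lambda>\<omega>. (-1::real) ^ (N t \<omega> - N s \<omega>))
      = (\<integral>k. (-1) ^ k \<partial>distr M (count_space UNIV) (\<lambda>\<omega>. N t \<omega> - N s \<omega>))"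
    using assms by (subst integral_distr) (auto intro!: increment_measurable)
  then show ?thesis
    using assms rate_pos by (simp add: increment_distr poisson_expectation_parity algebra_simps)
qed

text \<open>
  To the right of \<open>t\<close> this is right continuity of an integer-valued path.  To the left, a jump at \<open>t\<close>
  would give \<open>N\<close> a positive increment over every interval \<open>(t - \<delta>, t]\<close>, and the probability of that
  is \<open>1 - exp (-c\<delta>)\<close>.
\<close>

lemma AE_locally_constant:
  assumes "t \<ge> 0"
  shows "AE \<omega> in M. \<forall>\<^sub>F s in at t within {0..}. N s \<omega> = N t \<omega>"
proof -
  have right: "\<forall>\<^sub>F s in at_right t. N s \<omega> = N t \<omega>" if "\<omega> \<in> space M" for \<omega>
    using path_right_continuous[OF that assms] by (simp add: continuous_within tendsto_discrete)
  show ?thesis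
  proof (cases "t = 0")
    case True
    then show ?thesis
      using right by (auto simp: at_within_Ici_at_right)
  next
    case False
    with assms have "t > 0" by simp
    \<comment> \<open>Times increasing to \<open>t\<close>, with \<open>s 0 = 0\<close>.\<close>
    define s where "s n = t * (1 - inverse (real (Suc n)))" for n
    have s: "0 \<le> s n" "s n < t" for n
      using \<open>t > 0\<close> by (auto simp: s_def inverse_le_1_iff intro!: mult_nonneg_nonneg)
    define B where "B n = {\<omega> \<in> space M. N t \<omega> \<noteq> N (s n) \<omega>}" for n
    have B [measurable]: "B n \<in> events" for n
      unfolding B_def using s[of n] by (intro jump_event) auto
    have "(\<lambda>n. 1 - exp (- c * (t - s n))) \<longlonglongrightarrow> 1 - exp (- c * (t - t * (1 - 0)))"
      unfolding s_def by (intro tendsto_intros LIMSEQ_inverse_real_of_nat)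
    then have "(\<lambda>n. prob (B n)) \<longlonglongrightarrow> 0"
      using prob_increment_pos[OF s] by (simp add: B_def)
    then have "prob (\<Inter>n. B n) \<le> 0"
      by (rule LIMSEQ_le_const) (intro exI allI impI finite_measure_mono, auto)
    then have "(\<Inter>n. B n) \<in> null_sets M"
      by (intro null_setsI) (auto simp: emeasure_eq_measure measure_le_0_iff)
    then have "AE \<omega> in M. \<omega> \<notin> (\<Inter>n. B n)"
      by (rule AE_not_in)
    then show ?thesis
    proof (rule AE_mp, intro AE_I2 impI)
      fix \<omega> assume \<omega>: "\<omega> \<in> space M" "\<omega> \<notin> (\<Inter>n. B n)"
      then obtain n where n: "N t \<omega> = N (s n) \<omega>" by (auto simp: B_def)
      have "N r \<omega> = N t \<omega>" if "r \<in> {s n<..<t}" for r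
        using N_mono[OF \<omega>(1), of "s n" r] N_mono[OF \<omega>(1), of r t] that n s(1)[of n] by simp
      then have "\<forall>\<^sub>F r in at_left t. N r \<omega> = N t \<omega>"
        using eventually_at_left_real[OF s(2)[of n]] by (auto elim: eventually_mono)
      with right[OF \<omega>(1)] have "\<forall>\<^sub>F r in at t. N r \<omega> = N t \<omega>"
        by (simp add: eventually_at_split)
      then show "\<forall>\<^sub>F r in at t within {0..}. N r \<omega> = N t \<omega>"
        using at_le[of "{0..}" UNIV t] by (auto simp: le_filter_def)
    qed
  qed
qed

text \<open>
  Up to time \<open>s\<close> only the increments over the cells of the partition occur; the increment from
  \<open>s\<close> to \<open>t\<close> is appended as one more, independent of all of them, and
  \<open>\<epsilon>\<^sub>t = \<epsilon>\<^sub>s (-1)\<^bsup>N\<^sub>t - N\<^sub>s\<^esup>\<close>.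
\<close>

lemma riemann_sum_direction_increment:
  assumes "0 \<le> s" "s < t" "0 < n" and \<psi>: "continuous_on UNIV \<psi>"
  shows "expectation (\<lambda>\<omega>. \<psi> (riemann_sum s n \<omega>) * direction t \<omega>)
       = exp (- 2 * c * (t - s)) * expectation (\<lambda>\<omega>. \<psi> (riemann_sum s n \<omega>) * direction s \<omega>)"
proof -
  define h where "h = s / n"
  have "h \<ge> 0" using assms by (simp add: h_def)
  have nh: "real n * h = s" using assms by (simp add: h_def)
  \<comment> \<open>The points \<open>\<tau> 0, \<dots>, \<tau> n\<close> divide \<open>[0, s]\<close>; all later ones equal \<open>t\<close>, so increment number \<open>n\<close>
    is the one from \<open>s\<close> to \<open>t\<close>.\<close>
  define \<tau> where "\<tau> i = (if i \<le> n then real i * h else t)" for i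
  have le_s: "real i * h \<le> s" if "i \<le> n" for i
    using mult_right_mono[of "real i" "real n" h] that \<open>h \<ge> 0\<close> nh by simp
  have "mono \<tau>"
    using \<open>h \<ge> 0\<close> le_s \<open>s < t\<close> by (auto simp: mono_def \<tau>_def intro!: mult_right_mono) (meson less_le order_trans)
  have \<tau>_nonneg: "0 \<le> \<tau> i" for i
    using \<open>h \<ge> 0\<close> assms by (auto simp: \<tau>_def)
  define I where "I i \<omega> = N (\<tau> (Suc i)) \<omega> - N (\<tau> i) \<omega>" for i \<omega>
  have I: "I i \<in> measurable M (count_space UNIV)" for i
    unfolding I_def[abs_def] by (intro increment_measurable \<tau>_nonneg)
  have "indep_vars (\<lambda>_. count_space UNIV) I {..<Suc n}"
    unfolding I_def[abs_def] by (rule independent_increments[OF \<tau>_nonneg \<open>mono \<tau>\<close>])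
  then have ind: "indep_var (PiM {..<n} (\<lambda>_. count_space UNIV)) (\<lambda>\<omega>. \<lambda>i\<in>{..<n}. I i \<omega>)
      (PiM {n} (\<lambda>_. count_space UNIV)) (\<lambda>\<omega>. \<lambda>i\<in>{n}. I i \<omega>)"
    by (rule indep_var_restrict) auto
  \<comment> \<open>\<open>G\<close> rebuilds the Riemann sum and \<open>\<epsilon>\<^sub>s\<close> from the increments: the direction at a partition point is the
    product of the parities of the preceding increments, because \<open>N\<^sub>0 = 0\<close> almost surely.\<close>
  define G :: "(nat \<Rightarrow> nat) \<Rightarrow> real" where
    "G y = \<psi> (h * (\<Sum>k<n. \<Prod>j<Suc k. (-1) ^ y j)) * (\<Prod>j<n. (-1) ^ y j)" for y
  define H :: "(nat \<Rightarrow> nat) \<Rightarrow> real" where "H y = (-1) ^ y n" for y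
  have parity: "(\<lambda>y. (-1::real) ^ y j) \<in> borel_measurable (PiM A (\<lambda>_. count_space (UNIV :: nat set)))" if "j \<in> A" for j A
    by (rule measurable_compose[OF measurable_component_singleton[OF that, where M="\<lambda>_. count_space UNIV"]]) simp
  have G: "G \<in> borel_measurable (PiM {..<n} (\<lambda>_. count_space UNIV))"
    unfolding G_def[abs_def]
    by (intro borel_measurable_times borel_measurable_const borel_measurable_sum
        borel_measurable_prod parity measurable_compose[OF _ borel_measurable_continuous_onI[OF \<psi>]]) auto
  have H: "H \<in> borel_measurable (PiM {n} (\<lambda>_. count_space UNIV))"
    unfolding H_def[abs_def] by (intro parity) auto
  define X where "X \<omega> = G (\<lambda>i\<in>{..<n}. I i \<omega>)" for \<omega>
  define Y where "Y \<omega> = H (\<lambda>i\<in>{n}. I i \<omega>)" for \<omega>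
  have XY: "indep_var borel X borel Y"
    using indep_var_compose[OF ind G H] by (simp add: comp_def X_def[abs_def] Y_def[abs_def])
  have Y_eq: "Y \<omega> = (-1) ^ (N t \<omega> - N s \<omega>)" for \<omega>
    by (simp add: Y_def H_def I_def \<tau>_def nh)
  have X_eq: "X \<omega> = \<psi> (riemann_sum s n \<omega>) * direction s \<omega>"
    if \<omega>: "\<omega> \<in> space M" and "N 0 \<omega> = 0" for \<omega>
  proof -
    have "(\<Sum>j<m. I j \<omega>) = N (\<tau> m) \<omega>" for m
    proof (induction m)
      case 0
      then show ?case using \<open>N 0 \<omega> = 0\<close> by (simp add: \<tau>_def)
    next
      case (Suc m)
      then show ?case
        using N_mono[OF \<omega> \<tau>_nonneg, of m "\<tau> (Suc m)"] \<open>mono \<tau>\<close> by (simp add: I_def mono_def)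
    qed
    then have "(\<Prod>j<m. (-1) ^ I j \<omega>) = direction (\<tau> m) \<omega>" for m
      by (simp add: direction_def flip: power_sum)
    from this[of n] this[of "Suc k" for k] show ?thesis
      unfolding X_def G_def riemann_sum_def
      by (auto simp: \<tau>_def nh simp flip: h_def cong: sum.cong_simp prod.cong_simp)
  qed
  obtain C where C: "\<And>y. \<bar>y\<bar> \<le> s \<Longrightarrow> \<bar>\<psi> y\<bar> \<le> C"
    using continuous_bounded_on_interval[OF \<psi>] by metis
  have AE_X: "AE \<omega> in M. X \<omega> = \<psi> (riemann_sum s n \<omega>) * direction s \<omega>"
    using N_zero by (rule AE_mp) (auto intro!: AE_I2 X_eq)
  have X_meas: "X \<in> borel_measurable M" and Y_meas: "Y \<in> borel_measurable M"
    using XY by (auto simp: indep_var_rv1 indep_var_rv2)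
  have "integrable M X"
    using AE_X C[OF abs_riemann_sum_le[OF \<open>0 \<le> s\<close>]]
    by (intro integrable_const_bound[where B=C] X_meas) (auto simp: abs_mult elim!: eventually_mono)
  moreover have "integrable M Y"
    by (intro integrable_const_bound[where B=1] Y_meas) (auto simp: Y_eq power_abs)
  ultimately have prod: "expectation (\<lambda>\<omega>. X \<omega> * Y \<omega>) = expectation X * expectation Y"
    using XY by (intro indep_var_lebesgue_integral)
  have "s \<ge> 0" "t \<ge> 0" using assms by auto
  note meas = measurable_compose[OF measurable_riemann_sum[OF \<open>s \<ge> 0\<close>, of n] borel_measurable_continuous_onI[OF \<psi>]]
    measurable_direction[OF \<open>s \<ge> 0\<close>] measurable_direction[OF \<open>t \<ge> 0\<close>]
  have flip: "direction s \<omega> * (-1) ^ (N t \<omega> - N s \<omega>) = direction t \<omega>" if "\<omega> \<in> space M" for \<omega>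
    using N_mono[OF that \<open>s \<ge> 0\<close>, of t] \<open>s < t\<close> by (simp add: direction_def flip: power_add)
  have "expectation (\<lambda>\<omega>. \<psi> (riemann_sum s n \<omega>) * direction t \<omega>) = expectation (\<lambda>\<omega>. X \<omega> * Y \<omega>)"
  proof (rule integral_cong_AE)
    show "AE \<omega> in M. \<psi> (riemann_sum s n \<omega>) * direction t \<omega> = X \<omega> * Y \<omega>"
      using AE_X AE_space by eventually_elim (simp add: Y_eq mult.assoc flip)
  qed (use meas X_meas Y_meas in auto)
  also note prod
  also have "expectation X = expectation (\<lambda>\<omega>. \<psi> (riemann_sum s n \<omega>) * direction s \<omega>)"
    using AE_X meas X_meas by (intro integral_cong_AE) auto
  finally show ?thesis
    using expectation_increment_parity[OF \<open>0 \<le> s\<close> \<open>s < t\<close>] by (simp add: Y_eq mult.commute)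
qed

text \<open>
  The form of the Markov property that produces the damping term: waiting from \<open>s\<close> to \<open>t\<close> multiplies
  the correlation of the direction with the past by \<open>exp (-2c(t-s))\<close>.
\<close>

lemma expectation_direction_later:
  assumes "0 \<le> s" "s \<le> t" and \<psi>: "continuous_on UNIV \<psi>"
  shows "expectation (\<lambda>\<omega>. \<psi> (displacement s \<omega>) * direction t \<omega>)
       = exp (- 2 * c * (t - s)) * expectation (\<lambda>\<omega>. \<psi> (displacement s \<omega>) * direction s \<omega>)"
proof (cases "s = t")
  case False
  then have "s < t" using assms by simp
  obtain C where C: "\<And>y. \<bar>y\<bar> \<le> s \<Longrightarrow> \<bar>\<psi> y\<bar> \<le> C"
    using continuous_bounded_on_interval[OF \<psi>] by metis
  have "(\<lambda>n. expectation (\<lambda>\<omega>. \<psi> (riemann_sum s (Suc n) \<omega>) * direction r \<omega>))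
      \<longlonglongrightarrow> expectation (\<lambda>\<omega>. \<psi> (displacement s \<omega>) * direction r \<omega>)" if "r \<ge> 0" for r
  proof (rule integral_dominated_convergence[where w="\<lambda>_. C"])
    show "AE \<omega> in M. (\<lambda>n. \<psi> (riemann_sum s (Suc n) \<omega>) * direction r \<omega>)
        \<longlonglongrightarrow> \<psi> (displacement s \<omega>) * direction r \<omega>"
    proof (intro AE_I2 tendsto_mult tendsto_const)
      fix \<omega> assume "\<omega> \<in> space M"
      from riemann_sum_tendsto[OF this \<open>0 \<le> s\<close>]
      show "(\<lambda>n. \<psi> (riemann_sum s (Suc n) \<omega>)) \<longlonglongrightarrow> \<psi> (displacement s \<omega>)"
        by (rule continuous_on_tendsto_compose[OF \<psi>]) auto
    qed
  qed (use C[OF abs_riemann_sum_le[OF \<open>0 \<le> s\<close>]] in \<open>auto simp: abs_mult intro!: borel_measurable_times measurable_direction that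
       measurable_compose[OF measurable_riemann_sum[OF \<open>0 \<le> s\<close>] borel_measurable_continuous_onI[OF \<psi>]]
       measurable_compose[OF measurable_displacement[OF \<open>0 \<le> s\<close>] borel_measurable_continuous_onI[OF \<psi>]]\<close>)
  from this[of t] tendsto_mult_left[OF this[of s], of "exp (- 2 * c * (t - s))"]
  show ?thesis
    using assms \<open>s < t\<close>
    by (auto intro: LIMSEQ_unique simp: riemann_sum_direction_increment[OF _ _ _ \<psi>, of s t])
qed simp

end

section \<open>Expectations along the path and their derivatives\<close>

lemma continuous_derivative_locally_lipschitz:
  fixes \<phi> \<phi>' :: "real \<Rightarrow> real"
  assumes \<phi>: "\<And>y. (\<phi> has_real_derivative \<phi>' y) (at y)" and \<phi>': "continuous_on UNIV \<phi>'"
  obtains L where "L \<ge> 0" "\<And>u v. \<bar>u\<bar> \<le> R \<Longrightarrow> \<bar>v\<bar> \<le> R \<Longrightarrow> \<bar>\<phi> u - \<phi> v\<bar> \<le> L * \<bar>u - v\<bar>"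
proof -
  obtain L where L: "L \<ge> 0" "\<And>y. \<bar>y\<bar> \<le> R \<Longrightarrow> \<bar>\<phi>' y\<bar> \<le> L"
    using continuous_bounded_on_interval[OF \<phi>'] by metis
  have "\<bar>\<phi> u - \<phi> v\<bar> \<le> L * \<bar>u - v\<bar>" if "\<bar>u\<bar> \<le> R" "\<bar>v\<bar> \<le> R" for u v
  proof -
    have "norm (\<phi> u - \<phi> v) \<le> L * norm (u - v)"
      by (rule field_differentiable_bound[of "{-R..R}" \<phi> \<phi>'])
         (use L that in \<open>auto intro: has_field_derivative_at_within[OF \<phi>]\<close>)
    then show ?thesis by simp
  qed
  with L(1) show ?thesis by (rule that)
qed

context poisson_process
begin

text \<open>
  The exponent \<open>k\<close> only matters modulo \<open>2\<close>: \<open>k = 0\<close> is the plain expectation and \<open>k = 1\<close> the one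
  weighted by the direction of motion.  One definition for both lets continuity and the space derivative be
  proved once.
\<close>

definition telegraph_mean :: "real \<Rightarrow> (real \<Rightarrow> real) \<Rightarrow> nat \<Rightarrow> real \<Rightarrow> real \<Rightarrow> real" where
  "telegraph_mean a \<psi> k x t = expectation (\<lambda>\<omega>. \<psi> (x + a * displacement t \<omega>) * direction t \<omega> ^ k)"

lemma measurable_displaced:
  assumes "continuous_on UNIV \<psi>" "0 \<le> t"
  shows "(\<lambda>\<omega>. \<psi> (x + a * displacement t \<omega>) :: real) \<in> borel_measurable M"
  by (rule measurable_compose[OF _ borel_measurable_continuous_onI[OF assms(1)]])
     (intro borel_measurable_add borel_measurable_times borel_measurable_const measurable_displacement assms)

lemma abs_displaced_le:
  assumes "\<omega> \<in> space M" "0 \<le> t" "\<bar>x\<bar> \<le> X" "t \<le> T"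
  shows "\<bar>x + a * displacement t \<omega>\<bar> \<le> X + \<bar>a\<bar> * T"
proof -
  have "\<bar>a * displacement t \<omega>\<bar> \<le> \<bar>a\<bar> * T"
    unfolding abs_mult using abs_displacement_le[OF assms(1,2)] assms(4) by (intro mult_left_mono) auto
  then show ?thesis
    using abs_triangle_ineq[of x "a * displacement t \<omega>"] assms(3) by linarith
qed

lemma integrable_displaced:
  assumes \<psi>: "continuous_on UNIV \<psi>" and "0 \<le> t" "0 \<le> r"
  shows "integrable M (\<lambda>\<omega>. \<psi> (x + a * displacement t \<omega>) * direction r \<omega> ^ k :: real)"
proof -
  obtain C where C: "\<And>y. \<bar>y\<bar> \<le> \<bar>x\<bar> + \<bar>a\<bar> * t \<Longrightarrow> \<bar>\<psi> y\<bar> \<le> C"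
    using continuous_bounded_on_interval[OF \<psi>] by metis
  show ?thesis
    by (rule integrable_const_bound[where B=C])
       (use assms in \<open>auto simp: abs_mult power_abs intro!: C abs_displaced_le borel_measurable_times
          borel_measurable_power measurable_displaced measurable_direction\<close>)
qed

lemma continuous_displacement:
  assumes "\<omega> \<in> space M"
  shows "continuous_on {0..} (\<lambda>s. displacement s \<omega>)"
proof -
  have "\<bar>displacement s \<omega> - displacement r \<omega>\<bar> \<le> \<bar>s - r\<bar>" if "0 \<le> r" "0 \<le> s" for r s
    using displacement_lipschitz[OF assms, of r s] displacement_lipschitz[OF assms, of s r] that
    by (cases "r \<le> s") (auto simp: abs_minus_commute)
  then have "1-lipschitz_on {0..} (\<lambda>s. displacement s \<omega>)"
    by (intro lipschitz_onI) (auto simp: dist_real_def)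
  then show ?thesis by (rule lipschitz_on_continuous_on)
qed

lemma AE_direction_continuous:
  assumes "t \<ge> 0"
  shows "AE \<omega> in M. continuous (at t within {0..}) (\<lambda>s. direction s \<omega>)"
  using AE_locally_constant[OF assms]
proof eventually_elim
  fix \<omega> assume "\<forall>\<^sub>F s in at t within {0..}. N s \<omega> = N t \<omega>"
  then have "\<forall>\<^sub>F s in at t within {0..}. direction t \<omega> = direction s \<omega>"
    by eventually_elim (simp add: direction_def)
  then show "continuous (at t within {0..}) (\<lambda>s. direction s \<omega>)"
    unfolding continuous_within by (rule Lim_transform_eventually[OF tendsto_const])
qed

text \<open>
  Near a time at which \<open>N\<close> does not jump the displacement is linear.
\<close>

lemma AE_displacement_derivative:
  assumes "t \<ge> 0"
  shows "AE \<omega> in M. ((\<lambda>s. displacement s \<omega>) has_real_derivative direction t \<omega>) (at t within {0..})"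
  using AE_locally_constant[OF assms] AE_space
proof eventually_elim
  fix \<omega> assume "\<forall>\<^sub>F s in at t within {0..}. N s \<omega> = N t \<omega>" and \<omega>: "\<omega> \<in> space M"
  then obtain d where "d > 0" and d: "\<And>s. s \<ge> 0 \<Longrightarrow> s \<noteq> t \<Longrightarrow> dist s t < d \<Longrightarrow> N s \<omega> = N t \<omega>"
    by (auto simp: eventually_at)
  have dir: "direction s \<omega> = direction t \<omega>" if "s \<ge> 0" "dist s t < d" for s
    using d[of s] that by (cases "s = t") (auto simp: direction_def)
  have quot: "(displacement s \<omega> - displacement t \<omega>) / (s - t) = direction t \<omega>"
    if s: "s \<ge> 0" "s \<noteq> t" "dist s t < d" for s
  proof (cases "s < t")
    case True
    with s have "\<bar>displacement t \<omega> - displacement s \<omega> - direction t \<omega> * (t - s)\<bar> \<le> 0 * (t - s)"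
      by (intro displacement_approx \<omega>) (auto simp: dist_real_def intro!: dir)
    with s show ?thesis by (simp add: field_simps)
  next
    case False
    with s assms have "\<bar>displacement s \<omega> - displacement t \<omega> - direction t \<omega> * (s - t)\<bar> \<le> 0 * (s - t)"
      by (intro displacement_approx \<omega>) (auto simp: dist_real_def intro!: dir)
    with s show ?thesis by (simp add: field_simps)
  qed
  have "\<forall>\<^sub>F s in at t within {0..}. direction t \<omega> = (displacement s \<omega> - displacement t \<omega>) / (s - t)"
    unfolding eventually_at using \<open>d > 0\<close> quot by (intro exI[of _ d]) auto
  then show "((\<lambda>s. displacement s \<omega>) has_real_derivative direction t \<omega>) (at t within {0..})"
    unfolding has_field_derivative_iff by (rule Lim_transform_eventually[OF tendsto_const])
qed

text \<open>
  Almost surely the direction is continuous at the given time, even though its paths jump; bounded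
  convergence then applies, since near \<open>(x, t)\<close> the argument of \<open>\<psi>\<close> stays in a fixed compact interval.
\<close>

lemma continuous_telegraph_mean:
  assumes \<psi>: "continuous_on UNIV \<psi>"
  shows "continuous_on (UNIV \<times> {0..}) (\<lambda>(x, t). telegraph_mean a \<psi> k x t)"
  unfolding continuous_on_def
proof safe
  fix x t :: real assume "t \<ge> 0"
  let ?S = "UNIV \<times> {0..} :: (real \<times> real) set"
  let ?F = "at (x, t) within ?S"
  let ?X = "\<lambda>q \<omega>. \<psi> (fst q + a * displacement (snd q) \<omega>) * direction (snd q) \<omega> ^ k"
  obtain C where C: "\<And>y. \<bar>y\<bar> \<le> \<bar>x\<bar> + 1 + \<bar>a\<bar> * (t + 1) \<Longrightarrow> \<bar>\<psi> y\<bar> \<le> C"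
    using continuous_bounded_on_interval[OF \<psi>] by metis
  have inS: "\<forall>\<^sub>F q in ?F. q \<in> ?S"
    by (simp add: eventually_at_filter)
  have to_x: "(fst \<longlongrightarrow> x) ?F" and to_t: "(snd \<longlongrightarrow> t) ?F"
    using tendsto_fst[OF tendsto_ident_at[of "(x, t)" ?S]] tendsto_snd[OF tendsto_ident_at[of "(x, t)" ?S]]
    by simp_all
  have "((\<lambda>q. expectation (?X q)) \<longlongrightarrow> expectation (?X (x, t))) ?F"
  proof (rule tendsto_expectation_at_within[where C=C])
    show "\<forall>\<^sub>F q in ?F. \<forall>\<omega>\<in>space M. \<bar>?X q \<omega>\<bar> \<le> C"
      using inS tendstoD[OF to_x zero_less_one] tendstoD[OF to_t zero_less_one]
    proof eventually_elim
      case (elim q)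
      then have "\<bar>fst q\<bar> \<le> \<bar>x\<bar> + 1" "snd q \<le> t + 1" "snd q \<ge> 0"
        by (auto simp: dist_real_def)
      then show ?case
        by (auto simp: abs_mult power_abs intro!: C abs_displaced_le)
    qed
    show "AE \<omega> in M. ((\<lambda>q. ?X q \<omega>) \<longlongrightarrow> ?X (x, t) \<omega>) ?F"
      using AE_direction_continuous[OF \<open>t \<ge> 0\<close>] AE_space
    proof eventually_elim
      fix \<omega> assume dir: "continuous (at t within {0..}) (\<lambda>s. direction s \<omega>)" and \<omega>: "\<omega> \<in> space M"
      have snd: "\<forall>\<^sub>F q in ?F. snd q \<in> {0..}"
        using inS by eventually_elim auto
      have "((\<lambda>q. displacement (snd q) \<omega>) \<longlongrightarrow> displacement t \<omega>) ?F"
        using \<open>t \<ge> 0\<close> by (intro continuous_on_tendsto_compose[OF continuous_displacement[OF \<omega>] to_t _ snd]) auto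
      then have "((\<lambda>q. \<psi> (fst q + a * displacement (snd q) \<omega>)) \<longlongrightarrow> \<psi> (x + a * displacement t \<omega>)) ?F"
        by (intro continuous_on_tendsto_compose[OF \<psi>] tendsto_intros to_x) auto
      moreover have "((\<lambda>q. direction (snd q) \<omega>) \<longlongrightarrow> direction t \<omega>) ?F"
        by (rule continuous_within_tendsto_compose[OF dir snd to_t])
      ultimately show "((\<lambda>q. ?X q \<omega>) \<longlongrightarrow> ?X (x, t) \<omega>) ?F"
        by (auto intro!: tendsto_intros)
    qed
  qed (use \<open>t \<ge> 0\<close> in \<open>auto intro!: borel_measurable_integrable integrable_displaced \<psi>\<close>)
  then show "((\<lambda>(x, t). telegraph_mean a \<psi> k x t) \<longlongrightarrow> telegraph_mean a \<psi> k x t) ?F"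
    by (simp add: telegraph_mean_def case_prod_unfold)
qed

lemma telegraph_mean_continuous_in_time:
  assumes \<psi>: "continuous_on UNIV \<psi>"
  shows "continuous_on {0..} (telegraph_mean a \<psi> k x)"
proof -
  have "continuous_on {0..} (\<lambda>t. (\<lambda>(x, t). telegraph_mean a \<psi> k x t) (x, t))"
    by (rule continuous_on_compose2[OF continuous_telegraph_mean[OF \<psi>]]) (auto intro!: continuous_intros)
  then show ?thesis by simp
qed

context
  fixes \<phi> \<phi>' :: "real \<Rightarrow> real"
  assumes \<phi>: "\<And>y. (\<phi> has_real_derivative \<phi>' y) (at y)" and \<phi>': "continuous_on UNIV \<phi>'"
begin

lemma C1_continuous: "continuous_on UNIV \<phi>"
  by (intro continuous_at_imp_continuous_on ballI DERIV_isCont[OF \<phi>])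

lemma telegraph_mean_has_derivative_space:
  assumes "t \<ge> 0"
  shows "((\<lambda>y. telegraph_mean a \<phi> k y t) has_real_derivative telegraph_mean a \<phi>' k x t) (at x)"
proof -
  let ?Z = "\<lambda>y \<omega>. \<phi> (y + a * displacement t \<omega>) * direction t \<omega> ^ k"
  let ?X = "\<lambda>y \<omega>. (?Z y \<omega> - ?Z x \<omega>) / (y - x)"
  obtain L where L: "L \<ge> 0" "\<And>u v. \<bar>u\<bar> \<le> \<bar>x\<bar> + 1 + \<bar>a\<bar> * t \<Longrightarrow> \<bar>v\<bar> \<le> \<bar>x\<bar> + 1 + \<bar>a\<bar> * t \<Longrightarrow> \<bar>\<phi> u - \<phi> v\<bar> \<le> L * \<bar>u - v\<bar>"
    using continuous_derivative_locally_lipschitz[OF \<phi> \<phi>'] by metis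
  have int: "integrable M (?Z y)" for y
    by (intro integrable_displaced C1_continuous assms)
  have "((\<lambda>y. expectation (?X y)) \<longlongrightarrow> telegraph_mean a \<phi>' k x t) (at x)"
    unfolding telegraph_mean_def
  proof (rule tendsto_expectation_at_within[where C=L])
    show "\<forall>\<^sub>F y in at x. \<forall>\<omega>\<in>space M. \<bar>?X y \<omega>\<bar> \<le> L"
      using tendstoD[OF tendsto_ident_at zero_less_one]
    proof eventually_elim
      case (elim y)
      show ?case
      proof
        fix \<omega> assume "\<omega> \<in> space M"
        then have "\<bar>\<phi> (y + a * displacement t \<omega>) - \<phi> (x + a * displacement t \<omega>)\<bar>
            \<le> L * \<bar>(y + a * displacement t \<omega>) - (x + a * displacement t \<omega>)\<bar>"
          using elim assms by (intro L(2) abs_displaced_le) (auto simp: dist_real_def)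
        then have "\<bar>?Z y \<omega> - ?Z x \<omega>\<bar> \<le> L * \<bar>y - x\<bar>"
          by (simp add: abs_mult power_abs flip: left_diff_distrib)
        then show "\<bar>?X y \<omega>\<bar> \<le> L"
          using L(1) by (cases "y = x") (auto simp: abs_divide field_simps)
      qed
    qed
    show "AE \<omega> in M. ((\<lambda>y. ?X y \<omega>) \<longlongrightarrow> \<phi>' (x + a * displacement t \<omega>) * direction t \<omega> ^ k) (at x)"
    proof (intro AE_I2)
      fix \<omega>
      have "((\<lambda>y. ?Z y \<omega>) has_real_derivative \<phi>' (x + a * displacement t \<omega>) * direction t \<omega> ^ k) (at x)"
        by (auto intro!: derivative_eq_intros DERIV_chain'[OF _ \<phi>])
      then show "((\<lambda>y. ?X y \<omega>) \<longlongrightarrow> \<phi>' (x + a * displacement t \<omega>) * direction t \<omega> ^ k) (at x)"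
        by (simp add: has_field_derivative_iff)
    qed
  qed (auto intro!: borel_measurable_integrable integrable_displaced C1_continuous \<phi>' assms
         Bochner_Integration.integrable_diff integrable_divide)
  then show ?thesis
    unfolding has_field_derivative_iff using int by (simp add: telegraph_mean_def)
qed

lemma difference_quotient_bounded:
  assumes "t \<ge> 0"
  obtains C where "\<forall>\<^sub>F r in at t within {0..}. \<forall>\<omega>\<in>space M.
      \<bar>(\<phi> (x + a * displacement r \<omega>) - \<phi> (x + a * displacement t \<omega>)) / (r - t)\<bar> \<le> C"
proof -
  let ?R = "\<bar>x\<bar> + \<bar>a\<bar> * (t + 1)"
  obtain L where L: "L \<ge> 0" "\<And>u v. \<bar>u\<bar> \<le> ?R \<Longrightarrow> \<bar>v\<bar> \<le> ?R \<Longrightarrow> \<bar>\<phi> u - \<phi> v\<bar> \<le> L * \<bar>u - v\<bar>"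
    using continuous_derivative_locally_lipschitz[OF \<phi> \<phi>'] by metis
  have "\<forall>\<^sub>F r in at t within {0..}. r \<ge> 0"
    by (simp add: eventually_at_filter)
  then have "\<forall>\<^sub>F r in at t within {0..}. \<forall>\<omega>\<in>space M.
      \<bar>(\<phi> (x + a * displacement r \<omega>) - \<phi> (x + a * displacement t \<omega>)) / (r - t)\<bar> \<le> L * \<bar>a\<bar>"
    using tendstoD[OF tendsto_ident_at zero_less_one]
  proof eventually_elim
    case (elim r)
    show ?case
    proof
      fix \<omega> assume \<omega>: "\<omega> \<in> space M"
      have "\<bar>displacement r \<omega> - displacement t \<omega>\<bar> \<le> \<bar>r - t\<bar>"
        using displacement_lipschitz[OF \<omega>, of r t] displacement_lipschitz[OF \<omega>, of t r] assms elim
        by (cases "r \<le> t") (auto simp: abs_minus_commute)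
      then have "L * \<bar>a * (displacement r \<omega> - displacement t \<omega>)\<bar> \<le> L * (\<bar>a\<bar> * \<bar>r - t\<bar>)"
        unfolding abs_mult using L(1) by (intro mult_left_mono) auto
      moreover have "\<bar>\<phi> (x + a * displacement r \<omega>) - \<phi> (x + a * displacement t \<omega>)\<bar>
          \<le> L * \<bar>(x + a * displacement r \<omega>) - (x + a * displacement t \<omega>)\<bar>"
        using elim assms \<omega> by (intro L(2) abs_displaced_le) (auto simp: dist_real_def)
      ultimately have "\<bar>\<phi> (x + a * displacement r \<omega>) - \<phi> (x + a * displacement t \<omega>)\<bar> \<le> L * \<bar>a\<bar> * \<bar>r - t\<bar>"
        by (simp add: algebra_simps)
      then show "\<bar>(\<phi> (x + a * displacement r \<omega>) - \<phi> (x + a * displacement t \<omega>)) / (r - t)\<bar> \<le> L * \<bar>a\<bar>"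
        using L(1) by (cases "r = t") (auto simp: abs_divide field_simps)
    qed
  qed
  then show ?thesis by (rule that)
qed

lemma AE_difference_quotient_tendsto:
  assumes "t \<ge> 0"
  shows "AE \<omega> in M. ((\<lambda>r. (\<phi> (x + a * displacement r \<omega>) - \<phi> (x + a * displacement t \<omega>)) / (r - t))
      \<longlongrightarrow> a * (\<phi>' (x + a * displacement t \<omega>) * direction t \<omega>)) (at t within {0..})"
  using AE_displacement_derivative[OF assms]
proof eventually_elim
  case (elim \<omega>)
  have "((\<lambda>r. \<phi> (x + a * displacement r \<omega>)) has_real_derivative
      a * (\<phi>' (x + a * displacement t \<omega>) * direction t \<omega>)) (at t within {0..})"
    by (rule DERIV_cong[OF DERIV_chain2[OF \<phi>]]) (auto intro!: derivative_eq_intros elim)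
  then show ?case
    by (simp add: has_field_derivative_iff)
qed

text \<open>
  The chain rule along a path, averaged: the velocity \<open>a \<epsilon>\<^sub>t\<close> turns weight \<open>0\<close> into weight \<open>1\<close>.
\<close>

lemma telegraph_mean_has_derivative_time_0:
  assumes "t \<ge> 0"
  shows "(telegraph_mean a \<phi> 0 x has_real_derivative a * telegraph_mean a \<phi>' 1 x t) (at t within {0..})"
proof -
  let ?Q = "\<lambda>r \<omega>. (\<phi> (x + a * displacement r \<omega>) - \<phi> (x + a * displacement t \<omega>)) / (r - t)"
  have int: "integrable M (\<lambda>\<omega>. \<phi> (x + a * displacement r \<omega>))" if "r \<ge> 0" for r
    using integrable_displaced[OF C1_continuous that that, of x a 0] by simp
  obtain C where C: "\<forall>\<^sub>F r in at t within {0..}. \<forall>\<omega>\<in>space M. \<bar>?Q r \<omega>\<bar> \<le> C"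
    by (rule difference_quotient_bounded[OF assms])
  have "((\<lambda>r. expectation (?Q r)) \<longlongrightarrow>
      expectation (\<lambda>\<omega>. a * (\<phi>' (x + a * displacement t \<omega>) * direction t \<omega>))) (at t within {0..})"
    by (rule tendsto_expectation_at_within[OF _ _ C AE_difference_quotient_tendsto[OF assms]])
       (auto intro!: borel_measurable_divide borel_measurable_diff borel_measurable_times
          measurable_displaced measurable_direction C1_continuous \<phi>' assms)
  moreover have "\<forall>\<^sub>F r in at t within {0..}. expectation (?Q r)
      = (telegraph_mean a \<phi> 0 x r - telegraph_mean a \<phi> 0 x t) / (r - t)"
    using int assms by (auto simp: eventually_at_filter telegraph_mean_def)
  ultimately show ?thesis
    unfolding has_field_derivative_iff
    by (auto simp: telegraph_mean_def elim: Lim_transform_eventually)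
qed

text \<open>
  The velocity contributes \<open>a \<epsilon>\<^sub>t \<epsilon>\<^sub>t = a\<close>.  The weight itself is not differentiable along a path, so its
  contribution is separated from the difference quotient by \<open>expectation_direction_later\<close>: the quotient is
  the sum of a decorrelation term and of an average in which both positions carry the weight of the later time.
\<close>

lemma telegraph_mean_has_derivative_time_1:
  assumes "t \<ge> 0"
  shows "(telegraph_mean a \<phi> 1 x has_real_derivative
      a * telegraph_mean a \<phi>' 0 x t - 2 * c * telegraph_mean a \<phi> 1 x t) (at t within {0..})"
proof -
  let ?F = "at t within {0..}"
  let ?Z = "\<lambda>r \<omega>. \<phi> (x + a * displacement r \<omega>)"
  let ?Q = "\<lambda>r \<omega>. (?Z r \<omega> - ?Z t \<omega>) / (r - t)"
  let ?V = "telegraph_mean a \<phi> 1 x"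
  have int: "integrable M (\<lambda>\<omega>. ?Z r \<omega> * direction s \<omega>)" if "r \<ge> 0" "s \<ge> 0" for r s
    using integrable_displaced[OF C1_continuous that, of x a 1] by simp
  have nonneg: "\<forall>\<^sub>F r in ?F. r \<ge> 0 \<and> r \<noteq> t"
    by (simp add: eventually_at_filter)
  have later: "expectation (\<lambda>\<omega>. ?Z r \<omega> * direction s \<omega>) = exp (- 2 * c * (s - r)) * ?V r"
    if "0 \<le> r" "r \<le> s" for r s
  proof -
    have "continuous_on UNIV (\<lambda>y. \<phi> (x + a * y))"
      by (intro continuous_on_compose2[OF C1_continuous] continuous_intros) auto
    from expectation_direction_later[OF that this] show ?thesis
      by (simp add: telegraph_mean_def)
  qed
  \<comment> \<open>Both one-sided quotients have the same form once the earlier time is written \<open>min r t\<close> and the later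
    one \<open>max r t\<close>.\<close>
  have split: "(?V r - ?V t) / (r - t) = (exp (- 2 * c * \<bar>r - t\<bar>) - 1) / \<bar>r - t\<bar> * ?V (min r t)
      + expectation (\<lambda>\<omega>. ?Q r \<omega> * direction (max r t) \<omega>)" if r: "r \<ge> 0" "r \<noteq> t" for r
  proof -
    have alg: "(v - w) / d = (e - 1) / d * w + (v - e * w) / d"
      "(v - w) / d = (e - 1) / (- d) * v + (e * v - w) / d" for v w d e :: real
      by (simp_all add: diff_divide_distrib left_diff_distrib)
    have Q: "expectation (\<lambda>\<omega>. ?Q r \<omega> * direction s \<omega>) = (expectation (\<lambda>\<omega>. ?Z r \<omega> * direction s \<omega>)
        - expectation (\<lambda>\<omega>. ?Z t \<omega> * direction s \<omega>)) / (r - t)" if "s \<ge> 0" for s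
      using int[OF r(1) that] int[OF assms that] by (simp add: left_diff_distrib)
    show ?thesis
    proof (cases "r < t")
      case True
      have "expectation (\<lambda>\<omega>. ?Q r \<omega> * direction t \<omega>)
          = (exp (- 2 * c * (t - r)) * ?V r - ?V t) / (r - t)"
        unfolding Q[OF assms] using r True later[of r t] later[of t t] by simp
      with True alg(2)[of "?V r" "?V t" "r - t" "exp (- 2 * c * (t - r))"] show ?thesis
        by simp
    next
      case False
      have "expectation (\<lambda>\<omega>. ?Q r \<omega> * direction r \<omega>)
          = (?V r - exp (- 2 * c * (r - t)) * ?V t) / (r - t)"
        unfolding Q[OF r(1)] using False assms r(1) later[of t r] later[of r r] by simp
      with False alg(1)[of "?V r" "?V t" "r - t" "exp (- 2 * c * (r - t))"] show ?thesis
        by auto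
    qed
  qed
  obtain C where C: "\<forall>\<^sub>F r in ?F. \<forall>\<omega>\<in>space M. \<bar>?Q r \<omega>\<bar> \<le> C"
    by (rule difference_quotient_bounded[OF assms])
  have "((\<lambda>r. expectation (\<lambda>\<omega>. ?Q r \<omega> * direction (max r t) \<omega>)) \<longlongrightarrow>
      expectation (\<lambda>\<omega>. a * \<phi>' (x + a * displacement t \<omega>))) ?F"
  proof (rule tendsto_expectation_at_within[where C=C])
    show "\<forall>\<^sub>F r in ?F. \<forall>\<omega>\<in>space M. \<bar>?Q r \<omega> * direction (max r t) \<omega>\<bar> \<le> C"
      using C by eventually_elim (simp add: abs_mult)
    have max: "((\<lambda>r. max r t) \<longlongrightarrow> t) ?F"
      using tendsto_max[OF tendsto_ident_at[of t "{0..}"] tendsto_const[of t]] by simp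
    show "AE \<omega> in M. ((\<lambda>r. ?Q r \<omega> * direction (max r t) \<omega>) \<longlongrightarrow> a * \<phi>' (x + a * displacement t \<omega>)) ?F"
      using AE_difference_quotient_tendsto[OF assms, of x a] AE_direction_continuous[OF assms]
    proof eventually_elim
      case (elim \<omega>)
      have "((\<lambda>r. direction (max r t) \<omega>) \<longlongrightarrow> direction t \<omega>) ?F"
        by (rule continuous_within_tendsto_compose[OF elim(2) _ max]) (use assms in \<open>simp add: le_max_iff_disj\<close>)
      from tendsto_mult[OF elim(1) this] show ?case
        by (simp add: mult.assoc)
    qed
  qed (auto intro!: borel_measurable_divide borel_measurable_diff borel_measurable_times
         measurable_displaced measurable_direction C1_continuous \<phi>' assms continuous_intros)
  moreover have "((\<lambda>r. (exp (- 2 * c * \<bar>r - t\<bar>) - 1) / \<bar>r - t\<bar> * ?V (min r t)) \<longlongrightarrow> - 2 * c * ?V t) ?F"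
  proof (rule tendsto_mult)
    have "((\<lambda>y. exp (- 2 * c * y)) has_real_derivative - 2 * c) (at 0)"
      by (auto intro!: derivative_eq_intros)
    then have "((\<lambda>y. (exp (- 2 * c * y) - 1) / y) \<longlongrightarrow> - 2 * c) (at 0)"
      by (simp add: has_field_derivative_iff)
    moreover have "filterlim (\<lambda>r. \<bar>r - t\<bar>) (at 0) ?F"
    proof -
      have "((\<lambda>r. \<bar>r - t\<bar>) \<longlongrightarrow> \<bar>t - t\<bar>) ?F"
        by (intro tendsto_intros)
      then show ?thesis
        using nonneg by (auto simp: filterlim_at elim: eventually_mono)
    qed
    ultimately show "((\<lambda>r. (exp (- 2 * c * \<bar>r - t\<bar>) - 1) / \<bar>r - t\<bar>) \<longlongrightarrow> - 2 * c) ?F"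
      by (rule filterlim_compose)
    have min: "((\<lambda>r. min r t) \<longlongrightarrow> t) ?F"
      using tendsto_min[OF tendsto_ident_at[of t "{0..}"] tendsto_const[of t]] by simp
    show "((\<lambda>r. ?V (min r t)) \<longlongrightarrow> ?V t) ?F"
      by (rule continuous_on_tendsto_compose[OF telegraph_mean_continuous_in_time[OF C1_continuous] min])
         (use assms nonneg in \<open>auto elim: eventually_mono\<close>)
  qed
  ultimately have "((\<lambda>r. (exp (- 2 * c * \<bar>r - t\<bar>) - 1) / \<bar>r - t\<bar> * ?V (min r t)
      + expectation (\<lambda>\<omega>. ?Q r \<omega> * direction (max r t) \<omega>)) \<longlongrightarrow>
      - 2 * c * ?V t + expectation (\<lambda>\<omega>. a * \<phi>' (x + a * displacement t \<omega>))) ?F"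
    by (intro tendsto_add)
  then have "((\<lambda>r. (?V r - ?V t) / (r - t)) \<longlongrightarrow>
      - 2 * c * ?V t + expectation (\<lambda>\<omega>. a * \<phi>' (x + a * displacement t \<omega>))) ?F"
    by (rule Lim_transform_eventually) (use nonneg split in \<open>auto elim: eventually_mono\<close>)
  then show ?thesis
    unfolding has_field_derivative_iff by (simp add: telegraph_mean_def algebra_simps)
qed

end

end

section \<open>Calculus on the closed half-plane\<close>

lemma at_within_halfline_nontrivial: "t \<ge> 0 \<Longrightarrow> at t within {0..} \<noteq> (bot :: real filter)"
proof
  assume "t \<ge> 0" "at t within {0..} = bot"
  moreover from \<open>t \<ge> 0\<close> have "at_right t \<le> at t within {0..}"
    by (intro at_le) auto
  ultimately have "at_right t = bot"
    by (simp add: bot_unique)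
  then show False
    using trivial_limit_at_right_real[of t] by simp
qed

lemma C1_halfplane_has_derivative:
  assumes "C1_halfplane v" "t \<ge> 0"
  shows "((\<lambda>y. v y t) has_real_derivative partial_x v x t) (at x)"
    and "(v x has_real_derivative partial_t v x t) (at t within {0..})"
proof -
  show "((\<lambda>y. v y t) has_real_derivative partial_x v x t) (at x)"
    using assms by (simp add: C1_halfplane_def partial_x_def DERIV_deriv_iff_real_differentiable)
  show "(v x has_real_derivative partial_t v x t) (at t within {0..})"
    using assms by (simp add: C1_halfplane_def partial_t_def
        has_real_derivative_iff_has_vector_derivative flip: vector_derivative_works)
qed

lemma C1_halfplaneI:
  assumes x: "\<And>x t. t \<ge> 0 \<Longrightarrow> ((\<lambda>y. v y t) has_real_derivative vx x t) (at x)"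
    and t: "\<And>x t. t \<ge> 0 \<Longrightarrow> (v x has_real_derivative vt x t) (at t within {0..})"
    and "continuous_on (UNIV \<times> {0..}) (\<lambda>(x, t). vx x t)"
    and "continuous_on (UNIV \<times> {0..}) (\<lambda>(x, t). vt x t)"
  shows "C1_halfplane v"
    and "\<And>x t. t \<ge> 0 \<Longrightarrow> partial_x v x t = vx x t"
    and "\<And>x t. t \<ge> 0 \<Longrightarrow> partial_t v x t = vt x t"
proof -
  show px: "partial_x v x t = vx x t" if "t \<ge> 0" for x t
    using x[OF that] by (simp add: partial_x_def DERIV_imp_deriv)
  show pt: "partial_t v x t = vt x t" if "t \<ge> 0" for x t
    unfolding partial_t_def
    by (rule vector_derivative_within[OF at_within_halfline_nontrivial[OF that]])
       (use t[OF that] in \<open>simp add: has_real_derivative_iff_has_vector_derivative\<close>)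
  have "continuous_on (UNIV \<times> {0..}) (\<lambda>(x, t). partial_x v x t)"
    using assms(3) by (rule continuous_on_eq) (auto simp: px)
  moreover have "continuous_on (UNIV \<times> {0..}) (\<lambda>(x, t). partial_t v x t)"
    using assms(4) by (rule continuous_on_eq) (auto simp: pt)
  ultimately show "C1_halfplane v"
    unfolding C1_halfplane_def real_differentiable_def
    by (auto intro: x t)
qed

lemma C1_halfplane_cong:
  assumes eq: "\<And>x t. t \<ge> 0 \<Longrightarrow> v x t = v' x t" and v: "C1_halfplane v"
  shows "C1_halfplane v'"
    and "\<And>x t. t \<ge> 0 \<Longrightarrow> partial_x v' x t = partial_x v x t"
    and "\<And>x t. t \<ge> 0 \<Longrightarrow> partial_t v' x t = partial_t v x t"
proof -
  have x: "((\<lambda>y. v' y t) has_real_derivative partial_x v x t) (at x)" if "t \<ge> 0" for x t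
    using C1_halfplane_has_derivative(1)[OF v that] eq[OF that] by simp
  have t: "(v' x has_real_derivative partial_t v x t) (at t within {0..})" if "t \<ge> 0" for x t
    using C1_halfplane_has_derivative(2)[OF v that] eq that
    by (subst has_field_derivative_cong_eventually[where g="v x"]) (auto simp: eventually_at_filter)
  have cont: "continuous_on (UNIV \<times> {0..}) (\<lambda>(x, t). partial_x v x t)"
    "continuous_on (UNIV \<times> {0..}) (\<lambda>(x, t). partial_t v x t)"
    using v by (auto simp: C1_halfplane_def)
  note I = C1_halfplaneI[of v' "partial_x v" "partial_t v", OF x t cont]
  show "C1_halfplane v'"
    and "\<And>x t. t \<ge> 0 \<Longrightarrow> partial_x v' x t = partial_x v x t"
    and "\<And>x t. t \<ge> 0 \<Longrightarrow> partial_t v' x t = partial_t v x t"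
    using I by blast+
qed

lemma C1_halfplane_lincomb:
  assumes v: "C1_halfplane v" and w: "C1_halfplane w"
  shows "C1_halfplane (\<lambda>x t. p * v x t + q * w x t)"
    and "\<And>x t. t \<ge> 0 \<Longrightarrow>
      partial_x (\<lambda>x t. p * v x t + q * w x t) x t = p * partial_x v x t + q * partial_x w x t"
    and "\<And>x t. t \<ge> 0 \<Longrightarrow>
      partial_t (\<lambda>x t. p * v x t + q * w x t) x t = p * partial_t v x t + q * partial_t w x t"
proof -
  have x: "((\<lambda>y. p * v y t + q * w y t) has_real_derivative p * partial_x v x t + q * partial_x w x t) (at x)"
    if "t \<ge> 0" for x t
    using C1_halfplane_has_derivative(1)[OF v that] C1_halfplane_has_derivative(1)[OF w that]
    by (intro DERIV_add DERIV_cmult)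
  have t: "((\<lambda>t. p * v x t + q * w x t) has_real_derivative p * partial_t v x t + q * partial_t w x t) (at t within {0..})"
    if "t \<ge> 0" for x t
    using C1_halfplane_has_derivative(2)[OF v that] C1_halfplane_has_derivative(2)[OF w that]
    by (intro DERIV_add DERIV_cmult)
  have "continuous_on (UNIV \<times> {0..}) (\<lambda>(x, t). p * partial_x v x t + q * partial_x w x t)"
    "continuous_on (UNIV \<times> {0..}) (\<lambda>(x, t). p * partial_t v x t + q * partial_t w x t)"
    using v w by (auto simp: C1_halfplane_def case_prod_unfold intro!: continuous_intros)
  note I = C1_halfplaneI[of "\<lambda>x t. p * v x t + q * w x t", OF x t this]
  show "C1_halfplane (\<lambda>x t. p * v x t + q * w x t)"
    and "\<And>x t. t \<ge> 0 \<Longrightarrow>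
      partial_x (\<lambda>x t. p * v x t + q * w x t) x t = p * partial_x v x t + q * partial_x w x t"
    and "\<And>x t. t \<ge> 0 \<Longrightarrow>
      partial_t (\<lambda>x t. p * v x t + q * w x t) x t = p * partial_t v x t + q * partial_t w x t"
    using I by blast+
qed

text \<open>
  The part of \<open>telegraph_solution\<close> that is linear and homogeneous in \<open>v\<close>; the initial conditions are split
  off because the two summands of the averaged wave satisfy the one on \<open>\<partial>\<^sub>t v\<close> only jointly.
\<close>

definition telegraph_equation :: "real \<Rightarrow> real \<Rightarrow> (real \<Rightarrow> real \<Rightarrow> real) \<Rightarrow> bool" where
  "telegraph_equation c a v \<longleftrightarrow> C2_halfplane v \<and>
     (\<forall>x. \<forall>t\<ge>0. partial_t (partial_t v) x t + 2 * c * partial_t v x t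
                 = a\<^sup>2 * partial_x (partial_x v) x t)"

lemma telegraph_solution_iff:
  "telegraph_solution c a f v \<longleftrightarrow>
     telegraph_equation c a v \<and> (\<forall>x. v x 0 = f x) \<and> (\<forall>x. partial_t v x 0 = 0)"
  by (auto simp: telegraph_solution_def telegraph_equation_def)

lemma telegraph_equation_lincomb:
  assumes v: "telegraph_equation c a v" and w: "telegraph_equation c a w"
  shows "telegraph_equation c a (\<lambda>x t. p * v x t + q * w x t)"
proof -
  let ?z = "\<lambda>x t. p * v x t + q * w x t"
  have C1: "C1_halfplane v" "C1_halfplane (partial_x v)" "C1_halfplane (partial_t v)"
    "C1_halfplane w" "C1_halfplane (partial_x w)" "C1_halfplane (partial_t w)"
    using v w by (auto simp: telegraph_equation_def C2_halfplane_def)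
  note z = C1_halfplane_lincomb[OF C1(1,4), where p=p and q=q]
  note zx = C1_halfplane_lincomb[OF C1(2,5), where p=p and q=q]
  note zt = C1_halfplane_lincomb[OF C1(3,6), where p=p and q=q]
  note zx' = C1_halfplane_cong[OF z(2)[symmetric] zx(1)]
  note zt' = C1_halfplane_cong[OF z(3)[symmetric] zt(1)]
  have "p * (partial_t (partial_t v) x t + 2 * c * partial_t v x t)
      + q * (partial_t (partial_t w) x t + 2 * c * partial_t w x t)
      = p * (a\<^sup>2 * partial_x (partial_x v) x t) + q * (a\<^sup>2 * partial_x (partial_x w) x t)"
    if "t \<ge> 0" for x t
    using v w that by (simp add: telegraph_equation_def)
  then show ?thesis
    unfolding telegraph_equation_def C2_halfplane_def
    using v w z(1) zx'(1) zt'(1)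
    by (auto simp: z(3) zx'(2) zx(2) zt'(3) zt(3) telegraph_equation_def algebra_simps)
qed

text \<open>
  Differentiate \<open>v(x,t) = v(x,0) + \<integral>\<^sub>0\<^sup>t \<partial>\<^sub>t v(x,s) ds\<close> in \<open>x\<close> under the integral sign, then in
  \<open>t\<close>.  This argument covers the boundary line \<open>t = 0\<close>, where only one-sided derivatives exist.
\<close>

lemma mixed_partials_commute:
  assumes "C2_halfplane v" "t \<ge> 0"
  shows "partial_t (partial_x v) x t = partial_x (partial_t v) x t"
proof -
  have C1: "C1_halfplane v" "C1_halfplane (partial_x v)" "C1_halfplane (partial_t v)"
    using assms(1) by (auto simp: C2_halfplane_def)
  have sub: "UNIV \<times> {0..b} \<subseteq> UNIV \<times> {0::real..}" for b :: real by auto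
  have cont_t: "continuous_on {0..b} (\<lambda>s. partial_t v y s)" for y b
  proof -
    have "continuous_on {0..b} (\<lambda>s. (\<lambda>(x, t). partial_t v x t) (y, s))"
      by (rule continuous_on_compose2[of "UNIV \<times> {0..}"])
         (use C1(1) in \<open>auto simp: C1_halfplane_def intro!: continuous_intros\<close>)
    then show ?thesis by simp
  qed
  have cont_xt: "continuous_on (UNIV \<times> {0..b}) (\<lambda>(x, t). partial_x (partial_t v) x t)" for b
    using C1(3) continuous_on_subset[OF _ sub] by (auto simp: C1_halfplane_def)
  have cont_xt': "continuous_on {0..b} (\<lambda>s. partial_x (partial_t v) y s)" for y b
  proof -
    have "continuous_on {0..b} (\<lambda>s. (\<lambda>(x, t). partial_x (partial_t v) x t) (y, s))"
      by (rule continuous_on_compose2[OF cont_xt]) (auto intro!: continuous_intros)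
    then show ?thesis by simp
  qed
  have v_eq: "v y s = v y 0 + integral {0..s} (partial_t v y)" if "s \<ge> 0" for y s
  proof -
    have "(partial_t v y has_integral v y s - v y 0) {0..s}"
    proof (rule fundamental_theorem_of_calculus[OF that])
      fix r assume "r \<in> {0..s}"
      then have "(v y has_real_derivative partial_t v y r) (at r within {0..s})"
        by (intro has_field_derivative_subset[OF C1_halfplane_has_derivative(2)[OF C1(1)]]) auto
      then show "(v y has_vector_derivative partial_t v y r) (at r within {0..s})"
        by (simp add: has_real_derivative_iff_has_vector_derivative)
    qed
    then show ?thesis by (simp add: integral_unique)
  qed
  have vx_eq: "partial_x v x s = partial_x v x 0 + integral {0..s} (partial_x (partial_t v) x)" if "s \<ge> 0" for s
  proof -
    have "((\<lambda>y. integral (cbox 0 s) (partial_t v y)) has_real_derivative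
        integral (cbox 0 s) (partial_x (partial_t v) x)) (at x within UNIV)"
      by (rule leibniz_rule_field_derivative)
         (use cont_xt[of s] cont_t in \<open>auto intro!: C1_halfplane_has_derivative C1 integrable_continuous_real\<close>)
    then have "((\<lambda>y. v y 0 + integral {0..s} (partial_t v y)) has_real_derivative
        partial_x v x 0 + integral {0..s} (partial_x (partial_t v) x)) (at x)"
      by (intro DERIV_add C1_halfplane_has_derivative C1) auto
    then have "((\<lambda>y. v y s) has_real_derivative
        partial_x v x 0 + integral {0..s} (partial_x (partial_t v) x)) (at x)"
      by (simp flip: v_eq[OF that])
    then show ?thesis
      using C1_halfplane_has_derivative(1)[OF C1(1) that] DERIV_unique by blast
  qed
  let ?I = "{0..t + 1}"
  have ev: "\<forall>\<^sub>F s in at t within ?I.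
      partial_x v x s = partial_x v x 0 + integral {0..s} (partial_x (partial_t v) x)"
    unfolding eventually_at_filter by (auto intro!: always_eventually vx_eq)
  have "((\<lambda>s. integral {0..s} (partial_x (partial_t v) x)) has_real_derivative partial_x (partial_t v) x t) (at t within ?I)"
    by (rule integral_has_real_derivative[OF cont_xt']) (use assms in auto)
  then have "((\<lambda>s. partial_x v x 0 + integral {0..s} (partial_x (partial_t v) x)) has_real_derivative
      0 + partial_x (partial_t v) x t) (at t within ?I)"
    by (intro DERIV_add DERIV_const)
  then have 1: "(partial_x v x has_real_derivative partial_x (partial_t v) x t) (at t within ?I)"
    by (subst has_field_derivative_cong_eventually[OF ev vx_eq[OF assms(2)]]) simp
  have 2: "(partial_x v x has_real_derivative partial_t (partial_x v) x t) (at t within ?I)"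
    by (rule has_field_derivative_subset[OF C1_halfplane_has_derivative(2)[OF C1(2) assms(2)]]) auto
  show ?thesis
    by (rule vector_derivative_unique_within_closed_interval[of 0 "t + 1" t "partial_x v x"])
       (use 1 2 assms in \<open>auto simp: has_real_derivative_iff_has_vector_derivative\<close>)
qed

text \<open>
  Continuity of the partial derivatives makes \<open>v\<close> totally differentiable within the closed half-plane, so the
  chain rule holds along lines, one-sidedly where they start on the boundary.
\<close>

lemma C1_halfplane_chain:
  assumes v: "C1_halfplane v" and "t \<ge> 0"
  shows "((\<lambda>s. v (p + b * s) s) has_real_derivative
      b * partial_x v (p + b * t) t + partial_t v (p + b * t) t) (at t within {0..})"
proof -
  let ?x = "p + b * t"
  have joint: "((\<lambda>(x, t). v x t) has_derivative
      (\<lambda>(tx, ty). partial_x v ?x t * tx + blinfun_apply (blinfun_mult_right (partial_t v ?x t)) ty))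
      (at (?x, t) within UNIV \<times> {0..})"
  proof (rule has_derivative_partialsI)
    show "((\<lambda>y. v y t) has_derivative (*) (partial_x v ?x t)) (at ?x within UNIV)"
      using C1_halfplane_has_derivative(1)[OF v \<open>t \<ge> 0\<close>] by (simp add: has_field_derivative_def)
    show "(v y has_derivative blinfun_apply (blinfun_mult_right (partial_t v y s))) (at s within {0..})"
      if "s \<in> {0..}" for y s
      using C1_halfplane_has_derivative(2)[OF v, of s y] that by (simp add: has_field_derivative_def)
    have "continuous (at (?x, t) within UNIV \<times> {0..}) (\<lambda>(x, t). partial_t v x t)"
      using v \<open>t \<ge> 0\<close> by (auto simp: C1_halfplane_def continuous_on_eq_continuous_within)
    from bounded_linear.continuous[OF bounded_linear_blinfun_mult_right this]
    show "continuous (at (?x, t) within UNIV \<times> {0..}) (\<lambda>(x, t). blinfun_mult_right (partial_t v x t))"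
      by (simp add: case_prod_unfold)
  qed (use \<open>t \<ge> 0\<close> in auto)
  have line: "((\<lambda>s. (p + b * s, s)) has_derivative (\<lambda>h. (b * h, h))) (at t within {0..})"
    by (auto intro!: derivative_eq_intros)
  have "((\<lambda>(x, t). v x t) has_derivative
      (\<lambda>(tx, ty). partial_x v ?x t * tx + blinfun_apply (blinfun_mult_right (partial_t v ?x t)) ty))
      (at (?x, t) within (\<lambda>s. (p + b * s, s)) ` {0..})"
    by (rule has_derivative_subset[OF joint]) auto
  from has_derivative_in_compose[OF line this] have "((\<lambda>s. v (p + b * s) s) has_derivative
      (\<lambda>h. partial_x v ?x t * (b * h) + partial_t v ?x t * h)) (at t within {0..})"
    by simp
  then show ?thesis
    unfolding has_field_derivative_def
    by (rule has_derivative_eq_rhs) (simp add: fun_eq_iff algebra_simps)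
qed

section \<open>Uniqueness for the telegraph equation\<close>

text \<open>
  The left-hand side of the telegraph equation factors into the two transport operators
  \<open>\<partial>\<^sub>t - \<sigma> \<partial>\<^sub>x\<close> and \<open>\<partial>\<^sub>t + \<sigma> \<partial>\<^sub>x\<close> plus damping.  For \<open>c = 0\<close> the quantities \<open>z\<^sub>t \<plusminus> a z\<^sub>x\<close> are the Riemann
  invariants of the wave equation, constant along characteristics.
\<close>

lemma telegraph_riemann_invariant_derivative:
  assumes z: "telegraph_solution c a g z" and "\<sigma>\<^sup>2 = a\<^sup>2" "t \<ge> 0"
  shows "((\<lambda>s. partial_t z (p - \<sigma> * s) s + \<sigma> * partial_x z (p - \<sigma> * s) s) has_real_derivative
      - 2 * c * partial_t z (p - \<sigma> * t) t) (at t within {0..})"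
proof -
  let ?x = "p - \<sigma> * t"
  have C2: "C2_halfplane z"
    using z by (simp add: telegraph_solution_def)
  then have C1: "C1_halfplane (partial_x z)" "C1_halfplane (partial_t z)"
    by (auto simp: C2_halfplane_def)
  have "((\<lambda>s. partial_t z (p - \<sigma> * s) s + \<sigma> * partial_x z (p - \<sigma> * s) s) has_real_derivative
      (- \<sigma> * partial_x (partial_t z) ?x t + partial_t (partial_t z) ?x t)
      + \<sigma> * (- \<sigma> * partial_x (partial_x z) ?x t + partial_t (partial_x z) ?x t)) (at t within {0..})"
    using DERIV_add[OF C1_halfplane_chain[OF C1(2) assms(3), of p "- \<sigma>"]
        DERIV_cmult[OF C1_halfplane_chain[OF C1(1) assms(3), of p "- \<sigma>"], of \<sigma>]]
    by simp
  moreover have "partial_t (partial_t z) ?x t + 2 * c * partial_t z ?x t = \<sigma> * (\<sigma> * partial_x (partial_x z) ?x t)"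
    using z assms(2,3) by (simp add: telegraph_solution_def power2_eq_square mult.assoc flip: mult.assoc)
  ultimately show ?thesis
    using mixed_partials_commute[OF C2 assms(3), of ?x]
    by (elim DERIV_cong) (simp add: algebra_simps)
qed

text \<open>
  Since \<open>z\<^sub>t\<close> is the mean of the two Riemann invariants, it is dominated by their maximum \<open>W\<close>.  Integrating
  \<open>2c W \<le> 2c m exp (4cs)\<close> along a characteristic yields at most \<open>m/2 exp (4cs)\<close>; at a point of the triangle
  where the weighted maximum \<open>m\<close> is attained this reads \<open>m \<le> m/2\<close>.
\<close>

lemma telegraph_solution_zero:
  assumes "c > 0" "a > 0" and z: "telegraph_solution c a (\<lambda>_. 0) z" and "t \<ge> 0"
  shows "z x t = 0"
proof -
  have C1: "C1_halfplane z" "C1_halfplane (partial_x z)" "C1_halfplane (partial_t z)"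
    using z by (auto simp: telegraph_solution_def C2_halfplane_def)
  define R where "R \<sigma> y s = partial_t z y s + \<sigma> * partial_x z y s" for \<sigma> y s
  have R_init: "R \<sigma> y 0 = 0" for \<sigma> y
    using z by (simp add: R_def telegraph_solution_def partial_x_def)
  define W where "W q = max \<bar>R a (fst q) (snd q)\<bar> \<bar>R (- a) (fst q) (snd q)\<bar>" for q
  have zt_le: "\<bar>partial_t z y s\<bar> \<le> W (y, s)" for y s
    unfolding W_def R_def by (simp add: abs_le_iff max_def) linarith
  have W_cont: "continuous_on (UNIV \<times> {0..}) W"
    using C1(1) by (auto simp: W_def[abs_def] R_def C1_halfplane_def case_prod_unfold intro!: continuous_intros)
  have zt_zero: "partial_t z x T = 0" if "T \<ge> 0" for T
  proof -
    \<comment> \<open>The backward characteristic triangle with apex \<open>(x, T)\<close>, cut out of a rectangle so that compactness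
      is evident.\<close>
    define D where "D = ({x - a * T..x + a * T} \<times> {0..T}) \<inter> {q. \<bar>fst q - x\<bar> \<le> a * (T - snd q)}"
    have D: "(y, s) \<in> D \<longleftrightarrow> 0 \<le> s \<and> s \<le> T \<and> \<bar>y - x\<bar> \<le> a * (T - s)" for y s
    proof -
      have "a * (T - s) \<le> a * T" if "0 \<le> s"
        using that \<open>a > 0\<close> by (simp add: algebra_simps)
      then show ?thesis by (auto simp: D_def)
    qed
    have "compact D"
      unfolding D_def
      by (intro compact_Int_closed compact_Times closed_Collect_le continuous_intros) auto
    moreover have "(x, T) \<in> D" using that by (simp add: D)
    moreover have "continuous_on D (\<lambda>q. exp (- 4 * c * snd q) * W q)"
      by (intro continuous_intros continuous_on_subset[OF W_cont]) (auto simp: D_def)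
    ultimately obtain q where q: "q \<in> D"
      and q_max: "\<And>r. r \<in> D \<Longrightarrow> exp (- 4 * c * snd r) * W r \<le> exp (- 4 * c * snd q) * W q"
      using continuous_attains_sup[of D "\<lambda>q. exp (- 4 * c * snd q) * W q"] by blast
    obtain y1 s1 where q_eq: "q = (y1, s1)" by (cases q)
    define m where "m = exp (- 4 * c * s1) * W q"
    have W_le: "W (y, s) \<le> m * exp (4 * c * s)" if "(y, s) \<in> D" for y s
      using q_max[OF that] by (simp add: m_def q_eq exp_minus field_simps)
    have "m \<ge> 0" by (simp add: m_def W_def)
    have s1: "0 \<le> s1" "s1 \<le> T" "\<bar>y1 - x\<bar> \<le> a * (T - s1)"
      using q by (auto simp: q_eq D)
    have "\<bar>R \<sigma> y1 s1\<bar> \<le> m / 2 * exp (4 * c * s1)" if \<sigma>: "\<sigma> \<in> {a, - a}" for \<sigma>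
    proof (cases "s1 = 0")
      case True
      then show ?thesis using \<open>m \<ge> 0\<close> by (simp add: R_init)
    next
      case False
      with s1 have "s1 > 0" by simp
      \<comment> \<open>The characteristic through the maximum point \<open>(y1, s1)\<close>; it stays in the triangle down to time \<open>0\<close>.\<close>
      define p where "p = y1 + \<sigma> * s1"
      define \<rho> where "\<rho> s = R \<sigma> (p - \<sigma> * s) s" for s
      have \<rho>: "(\<rho> has_real_derivative - 2 * c * partial_t z (p - \<sigma> * s) s) (at s within {0..})" if "s \<ge> 0" for s
        unfolding \<rho>_def[abs_def] R_def
        using telegraph_riemann_invariant_derivative[OF z _ that, of \<sigma> p] \<sigma> by auto
      have "norm (\<rho> s1 - \<rho> 0) \<le> m / 2 * exp (4 * c * s1) - m / 2 * exp (4 * c * 0)"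
      proof (rule differentiable_bound_general[OF \<open>s1 > 0\<close>, where \<phi>="\<lambda>s. m / 2 * exp (4 * c * s)"
            and f'="\<lambda>s. - 2 * c * partial_t z (p - \<sigma> * s) s" and \<phi>'="\<lambda>s. 2 * c * (m * exp (4 * c * s))"])
        show "continuous_on {0..s1} \<rho>"
          by (rule DERIV_continuous_on, rule has_field_derivative_subset[OF \<rho>]) auto
        show "continuous_on {0..s1} (\<lambda>s. m / 2 * exp (4 * c * s))"
          by (intro continuous_intros)
        fix s assume s: "0 < s" "s < s1"
        show "(\<rho> has_vector_derivative - 2 * c * partial_t z (p - \<sigma> * s) s) (at s)"
          using \<rho>[of s] s at_within_interior[of s "{0..}"]
          by (simp add: has_real_derivative_iff_has_vector_derivative)
        show "((\<lambda>s. m / 2 * exp (4 * c * s)) has_vector_derivative 2 * c * (m * exp (4 * c * s))) (at s)"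
          unfolding has_real_derivative_iff_has_vector_derivative[symmetric]
          by (auto intro!: derivative_eq_intros)
        have "\<bar>\<sigma>\<bar> = a" using \<sigma> \<open>a > 0\<close> by auto
        then have "\<bar>(p - \<sigma> * s) - x\<bar> \<le> \<bar>y1 - x\<bar> + a * (s1 - s)"
        proof -
          have "(p - \<sigma> * s) - x = (y1 - x) + \<sigma> * (s1 - s)"
            by (simp add: p_def algebra_simps)
          moreover have "\<bar>\<sigma> * (s1 - s)\<bar> = a * (s1 - s)"
            using s \<open>\<bar>\<sigma>\<bar> = a\<close> by (simp add: abs_mult)
          ultimately show ?thesis
            using abs_triangle_ineq[of "y1 - x" "\<sigma> * (s1 - s)"] by simp
        qed
        with s1 s have "(p - \<sigma> * s, s) \<in> D"
          by (simp add: D algebra_simps)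
        then have "\<bar>partial_t z (p - \<sigma> * s) s\<bar> \<le> m * exp (4 * c * s)"
          using zt_le W_le order_trans by blast
        then show "norm (- 2 * c * partial_t z (p - \<sigma> * s) s) \<le> 2 * c * (m * exp (4 * c * s))"
          using \<open>c > 0\<close> by (simp add: abs_mult)
      qed
      with \<open>m \<ge> 0\<close> show ?thesis
        by (simp add: \<rho>_def R_init p_def)
    qed
    from this[of a] this[of "- a"] have "W q \<le> m / 2 * exp (4 * c * s1)"
      by (simp add: W_def q_eq)
    then have "m \<le> m / 2"
      by (simp add: m_def exp_minus field_simps)
    with \<open>m \<ge> 0\<close> have "m = 0" by simp
    with W_le[OF \<open>(x, T) \<in> D\<close>] zt_le[of x T] show ?thesis by simp
  qed
  have "\<exists>k. \<forall>s\<in>{0..}. z x s = k"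
    using C1_halfplane_has_derivative(2)[OF C1(1), of _ x] zt_zero
    by (intro has_field_derivative_zero_constant) auto
  then have "z x t = z x 0"
    using \<open>t \<ge> 0\<close> by auto
  also have "\<dots> = 0"
    using z by (simp add: telegraph_solution_def)
  finally show ?thesis .
qed

lemma telegraph_solution_unique:
  assumes "c > 0" "a > 0" and v: "telegraph_solution c a f v" and w: "telegraph_solution c a f w"
    and "t \<ge> 0"
  shows "v x t = w x t"
proof -
  let ?z = "\<lambda>x t. 1 * v x t + (- 1) * w x t"
  have C1: "C1_halfplane v" "C1_halfplane w"
    using v w by (auto simp: telegraph_solution_def C2_halfplane_def)
  have "telegraph_equation c a ?z"
    using v w by (intro telegraph_equation_lincomb) (auto simp: telegraph_solution_iff)
  moreover have "partial_t ?z x 0 = 0" for x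
    using v w by (subst C1_halfplane_lincomb(3)[OF C1]) (auto simp: telegraph_solution_iff)
  moreover have "?z x 0 = 0" for x
    using v w by (simp add: telegraph_solution_iff)
  ultimately have "telegraph_solution c a (\<lambda>_. 0) ?z"
    by (simp add: telegraph_solution_iff)
  from telegraph_solution_zero[OF assms(1,2) this assms(5), of x] show ?thesis by simp
qed

section \<open>The averaged wave\<close>

context poisson_process
begin

lemma telegraph_mean_at_0: "telegraph_mean a \<psi> k x 0 = \<psi> x * expectation (\<lambda>\<omega>. direction 0 \<omega> ^ k)"
  by (simp add: telegraph_mean_def)

context
  fixes f f' f'' :: "real \<Rightarrow> real"
  assumes f: "\<And>y. (f has_real_derivative f' y) (at y)"
    and f': "\<And>y. (f' has_real_derivative f'' y) (at y)"
    and f'': "continuous_on UNIV f''"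
begin

lemma first_derivative_continuous: "continuous_on UNIV f'"
  by (intro continuous_at_imp_continuous_on ballI DERIV_isCont[OF f'])

text \<open>
  With \<open>A\<close> and \<open>B\<close> for weight \<open>0\<close> and \<open>1\<close>:
  \<open>\<partial>\<^sub>t\<^sub>t A\<^sub>f = a \<partial>\<^sub>t B\<^sub>f\<^sub>' = a (a A\<^sub>f\<^sub>'\<^sub>' - 2c B\<^sub>f\<^sub>') = a\<^sup>2 \<partial>\<^sub>x\<^sub>x A\<^sub>f - 2c \<partial>\<^sub>t A\<^sub>f\<close>.
\<close>

lemma telegraph_mean_solves_equation:
  fixes a
  defines "V \<equiv> telegraph_mean a"
  shows "telegraph_equation c a (V f 0)"
    and "\<And>x t. t \<ge> 0 \<Longrightarrow> partial_t (V f 0) x t = a * V f' 1 x t"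
proof -
  have cont: "continuous_on (UNIV \<times> {0..}) (\<lambda>(x, t). V f' k x t)"
    "continuous_on (UNIV \<times> {0..}) (\<lambda>(x, t). V f'' k x t)" for k
    unfolding V_def by (intro continuous_telegraph_mean f'' first_derivative_continuous)+
  have cont': "continuous_on (UNIV \<times> {0..}) (\<lambda>(x, t). a * V f' 1 x t)"
    "continuous_on (UNIV \<times> {0..}) (\<lambda>(x, t). a * V f'' k x t)"
    "continuous_on (UNIV \<times> {0..}) (\<lambda>(x, t). a * (a * V f'' 0 x t - 2 * c * V f' 1 x t))" for k
    using cont unfolding case_prod_unfold by (auto intro!: continuous_intros)
  note f_x = telegraph_mean_has_derivative_space[OF f first_derivative_continuous, of _ a, folded V_def]
  note f'_x = telegraph_mean_has_derivative_space[OF f' f'', of _ a, folded V_def]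
  note f_t = telegraph_mean_has_derivative_time_0[OF f first_derivative_continuous, of _ a, folded V_def]
  note f'_t0 = telegraph_mean_has_derivative_time_0[OF f' f'', of _ a, folded V_def]
  note f'_t1 = telegraph_mean_has_derivative_time_1[OF f' f'', of _ a, folded V_def]
  note v = C1_halfplaneI[of "V f 0", OF f_x f_t cont(1) cont'(1)]
  note vx = C1_halfplaneI[of "V f' 0", OF f'_x f'_t0 cont(2) cont'(2)]
  note vt = C1_halfplaneI[of "\<lambda>x t. a * V f' 1 x t", OF DERIV_cmult[OF f'_x] DERIV_cmult[OF f'_t1] cont'(2,3)]
  note vx' = C1_halfplane_cong[OF v(2)[symmetric] vx(1)]
  note vt' = C1_halfplane_cong[OF v(3)[symmetric] vt(1)]
  show "partial_t (V f 0) x t = a * V f' 1 x t" if "t \<ge> 0" for x t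
    by (rule v(3)) (use that in auto)
  have "C2_halfplane (V f 0)"
    using v(1) vx'(1) vt'(1) by (simp add: C2_halfplane_def)
  moreover have "partial_t (partial_t (V f 0)) x t + 2 * c * partial_t (V f 0) x t
      = a\<^sup>2 * partial_x (partial_x (V f 0)) x t" if "t \<ge> 0" for x t
    using that by (simp add: v(3) vt'(3) vt(3) vx'(2) vx(2) power2_eq_square algebra_simps del: One_nat_def)
  ultimately show "telegraph_equation c a (V f 0)"
    by (simp add: telegraph_equation_def)
qed

text \<open>
  At \<open>t = 0\<close> the time derivatives of the two summands are \<open>\<plusminus>a f'(x) E[\<epsilon>\<^sub>0]\<close>, which cancel.
\<close>

lemma expected_wave_solves_telegraph:
  "telegraph_solution c a f
    (\<lambda>x t. 1/2 * telegraph_mean a f 0 x t + 1/2 * telegraph_mean (- a) f 0 x t)"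
proof -
  let ?V = "\<lambda>b. telegraph_mean b f 0"
  have eq: "telegraph_equation c a (?V a)" "telegraph_equation c a (?V (- a))"
    using telegraph_mean_solves_equation(1)[of a] telegraph_mean_solves_equation(1)[of "- a"]
    by (auto simp: telegraph_equation_def)
  then have C1: "C1_halfplane (?V a)" "C1_halfplane (?V (- a))"
    by (auto simp: telegraph_equation_def C2_halfplane_def)
  have "partial_t (\<lambda>x t. 1/2 * ?V a x t + 1/2 * ?V (- a) x t) x 0 = 0" for x
    by (subst C1_halfplane_lincomb(3)[OF C1])
       (auto simp: telegraph_mean_solves_equation(2) telegraph_mean_at_0)
  then show ?thesis
    using telegraph_equation_lincomb[OF eq, of "1/2" "1/2"]
    by (simp add: telegraph_solution_iff telegraph_mean_at_0 prob_space)
qed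

end

end

theorem proposition3p11:
  fixes M :: "'a measure" and N :: "real \<Rightarrow> 'a \<Rightarrow> nat" and c a :: real
    and f :: "real \<Rightarrow> real" and u w :: "real \<Rightarrow> real \<Rightarrow> real"
  assumes "c > 0" and "a > 0"
    and "f differentiable_on UNIV" and "deriv f differentiable_on UNIV"
    and "continuous_on UNIV (deriv (deriv f))"
    and "bounded (range (deriv f))" and "bounded (range (deriv (deriv f)))"
    and "poisson_process M N c"
  defines "u \<equiv> \<lambda>x t. (1 / 2) * (f (x + a * t) + f (x - a * t))"
  defines "w \<equiv> \<lambda>x t. \<integral>\<omega>. u x (LBINT s:{0..t}. (-1) ^ N s \<omega>) \<partial>M"
  shows "telegraph_solution c a f w \<and>
    (\<forall>v. telegraph_solution c a f v \<longrightarrow> (\<forall>x. \<forall>t\<ge>0. v x t = w x t))"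
proof -
  interpret poisson_process M N c by fact
  have f: "(f has_real_derivative deriv f y) (at y)"
    and f': "(deriv f has_real_derivative deriv (deriv f) y) (at y)" for y
    using assms(3,4) by (simp_all add: differentiable_on_def DERIV_deriv_iff_real_differentiable)
  have f_cont: "continuous_on UNIV f"
    by (rule differentiable_imp_continuous_on) fact
  have w: "w x t = 1/2 * telegraph_mean a f 0 x t + 1/2 * telegraph_mean (- a) f 0 x t"
    for x t
  proof -
    have int: "integrable M (\<lambda>\<omega>. f (x + b * displacement t \<omega>))" for b
    proof (cases "t \<ge> 0")
      case True
      then show ?thesis using integrable_displaced[OF f_cont True True, of x b 0] by simp
    next
      case False
      then show ?thesis by (simp add: displacement_def set_lebesgue_integral_def)
    qed
    have "w x t = expectation (\<lambda>\<omega>. 1/2 * (f (x + a * displacement t \<omega>) + f (x + (- a) * displacement t \<omega>)))"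
      by (simp add: w_def u_def displacement_def direction_def)
    also have "\<dots> = 1/2 * (expectation (\<lambda>\<omega>. f (x + a * displacement t \<omega>))
        + expectation (\<lambda>\<omega>. f (x + (- a) * displacement t \<omega>)))"
      by (simp only: integral_mult_right_zero Bochner_Integration.integral_add[OF int int])
    finally show ?thesis
      by (simp add: telegraph_mean_def)
  qed
  have "w = (\<lambda>x t. 1/2 * telegraph_mean a f 0 x t + 1/2 * telegraph_mean (- a) f 0 x t)"
    by (intro ext w)
  then have "telegraph_solution c a f w"
    using expected_wave_solves_telegraph[OF f f' assms(5), of a] by (simp only:)
  then show ?thesis
    using telegraph_solution_unique[OF \<open>c > 0\<close> \<open>a > 0\<close>] by blast
qed

end
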